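(* Let $n\ge 1$, $0<\mu\le 1$ and $$1<p\le 1+\frac{2}{n+(\mu-1)}.$$ Let $(u_0,u_1)\in H^1(\mathbf{R}^n)\times L^2(\mathbf{R}^n)$ have compact support and satisfy $$\int_{\mathbf{R}^n}u_1(x)\,dx>0.$$ Then there is no global solution of the Cauchy problem $$u_{tt}-\Delta u+\frac{\mu}{1+t}u_t=|u|^p\ \text{ in }(0,\infty)\times\mathbf{R}^n,\qquad (u,u_t)(0,x)=(u_0,u_1)(x).$$
   Context: All functions are real-valued. A global solution is a function $u\in C([0,\infty);H^1(\mathbf{R}^n))\cap C^1([0,\infty);L^2(\mathbf{R}^n))$ satisfying the equation in the sense of distributions on $(0,\infty)\times\mathbf{R}^n$, with the initial data attained in $H^1(\mathbf{R}^n)\times L^2(\mathbf{R}^n)$. *)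

theory Defs
  imports "HOL-Analysis.Analysis"
begin

text \<open>
  Elements of \<open>L\<^sup>2\<close> and \<open>H\<^sup>1\<close> are represented by Lebesgue measurable functions; two functions
  that agree almost everywhere represent the same element.
\<close>

primrec C_diff :: "nat \<Rightarrow> ('a::euclidean_space \<Rightarrow> real) \<Rightarrow> bool" where
  "C_diff 0 f \<longleftrightarrow> continuous_on UNIV f"
| "C_diff (Suc k) f \<longleftrightarrow>
     (\<forall>x. f differentiable (at x)) \<and>
     (\<forall>b\<in>Basis. C_diff k (\<lambda>x. frechet_derivative f (at x) b))"

definition test_functions :: "'a::euclidean_space set \<Rightarrow> ('a \<Rightarrow> real) set" where
  "test_functions \<Omega> =
     {\<phi>. (\<forall>k. C_diff k \<phi>) \<and> compact (closure {x. \<phi> x \<noteq> 0}) \<and> closure {x. \<phi> x \<noteq> 0} \<subseteq> \<Omega>}"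

definition locally_integrable_on :: "('a::euclidean_space \<Rightarrow> real) \<Rightarrow> 'a set \<Rightarrow> bool" where
  "locally_integrable_on f \<Omega> \<longleftrightarrow>
     (\<forall>K. compact K \<and> K \<subseteq> \<Omega> \<longrightarrow> set_integrable lebesgue K f)"

text \<open>
  A distribution is a functional on test functions.  The values of these functionals outside
  \<open>test_functions \<Omega>\<close> are irrelevant: equations between distributions on \<open>\<Omega>\<close> are
  always tested against \<open>\<phi> \<in> test_functions \<Omega>\<close>.
\<close>

type_synonym 'a distr = "('a \<Rightarrow> real) \<Rightarrow> real"

definition distr_of_fun :: "('a::euclidean_space \<Rightarrow> real) \<Rightarrow> 'a distr" where
  "distr_of_fun f = (\<lambda>\<phi>. LINT x|lebesgue. f x * \<phi> x)"

definition distr_deriv :: "'a::euclidean_space \<Rightarrow> 'a distr \<Rightarrow> 'a distr" where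
  "distr_deriv b T = (\<lambda>\<phi>. - T (\<lambda>x. frechet_derivative \<phi> (at x) b))"

definition distr_mult :: "('a::euclidean_space \<Rightarrow> real) \<Rightarrow> 'a distr \<Rightarrow> 'a distr" where
  "distr_mult a T = (\<lambda>\<phi>. T (\<lambda>x. a x * \<phi> x))"

definition L2 :: "('a::euclidean_space \<Rightarrow> real) set" where
  "L2 = {f. f \<in> borel_measurable lebesgue \<and> integrable lebesgue (\<lambda>x. (f x)\<^sup>2)}"

definition L2_norm :: "('a::euclidean_space \<Rightarrow> real) \<Rightarrow> real" where
  "L2_norm f = sqrt (LINT x|lebesgue. (f x)\<^sup>2)"

definition has_weak_deriv ::
  "('a::euclidean_space \<Rightarrow> real) \<Rightarrow> 'a \<Rightarrow> ('a \<Rightarrow> real) \<Rightarrow> bool" where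
  "has_weak_deriv f b g \<longleftrightarrow>
     (\<forall>\<phi>\<in>test_functions UNIV. distr_deriv b (distr_of_fun f) \<phi> = distr_of_fun g \<phi>)"

definition H1 :: "('a::euclidean_space \<Rightarrow> real) set" where
  "H1 = {f\<in>L2. \<forall>b\<in>Basis. \<exists>g\<in>L2. has_weak_deriv f b g}"

text \<open>The weak derivative in \<open>L\<^sup>2\<close> is unique up to a null set, so the choice does not matter.\<close>

definition weak_deriv :: "('a::euclidean_space \<Rightarrow> real) \<Rightarrow> 'a \<Rightarrow> 'a \<Rightarrow> real" where
  "weak_deriv f b = (SOME g. g \<in> L2 \<and> has_weak_deriv f b g)"

definition H1_norm :: "('a::euclidean_space \<Rightarrow> real) \<Rightarrow> real" where
  "H1_norm f = sqrt ((L2_norm f)\<^sup>2 + (\<Sum>b\<in>Basis. (L2_norm (weak_deriv f b))\<^sup>2))"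

text \<open>The support of an almost-everywhere class.\<close>

definition ess_support :: "('a::euclidean_space \<Rightarrow> real) \<Rightarrow> 'a set" where
  "ess_support f = - \<Union>{U. open U \<and> (AE x in lebesgue. x \<in> U \<longrightarrow> f x = 0)}"

text \<open>\<open>u \<in> C([0,\<infinity>); X)\<close>, where \<open>X\<close> carries the (semi)norm \<open>N\<close>.\<close>

definition continuous_curve ::
  "('a \<Rightarrow> real) set \<Rightarrow> (('a \<Rightarrow> real) \<Rightarrow> real) \<Rightarrow> (real \<Rightarrow> 'a \<Rightarrow> real) \<Rightarrow> bool" where
  "continuous_curve X N u \<longleftrightarrow>
     (\<forall>t\<ge>0. u t \<in> X \<and> ((\<lambda>s. N (\<lambda>x. u s x - u t x)) \<longlongrightarrow> 0) (at t within {0..}))"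

text \<open>\<open>u\<close> is differentiable as a curve in \<open>X\<close>, with derivative \<open>v\<close> (one-sided at \<open>0\<close>).\<close>

definition has_curve_deriv ::
  "('a \<Rightarrow> real) set \<Rightarrow> (('a \<Rightarrow> real) \<Rightarrow> real) \<Rightarrow> (real \<Rightarrow> 'a \<Rightarrow> real) \<Rightarrow> (real \<Rightarrow> 'a \<Rightarrow> real) \<Rightarrow> bool" where
  "has_curve_deriv X N u v \<longleftrightarrow>
     (\<forall>t\<ge>0. u t \<in> X \<and> v t \<in> X \<and>
        ((\<lambda>s. N (\<lambda>x. (u s x - u t x) / (s - t) - v t x)) \<longlongrightarrow> 0) (at t within {0..}))"

text \<open>
  \<open>w\<^sub>t\<^sub>t - \<Delta>w + \<mu>/(1+t) w\<^sub>t = |w|\<^sup>p\<close> in the sense of distributions on \<open>(0,\<infinity>) \<times> R\<^sup>n\<close>.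
  Local integrability makes \<open>w\<close> and \<open>|w|\<^sup>p\<close> distributions.
\<close>

definition distr_solution :: "real \<Rightarrow> real \<Rightarrow> (real \<times> 'a::euclidean_space \<Rightarrow> real) \<Rightarrow> bool" where
  "distr_solution \<mu> p w \<longleftrightarrow>
     locally_integrable_on w ({0<..} \<times> UNIV) \<and>
     locally_integrable_on (\<lambda>z. \<bar>w z\<bar> powr p) ({0<..} \<times> UNIV) \<and>
     (\<forall>\<phi>\<in>test_functions ({0<..} \<times> UNIV).
        distr_deriv (1, 0) (distr_deriv (1, 0) (distr_of_fun w)) \<phi>
        - (\<Sum>b\<in>Basis. distr_deriv (0, b) (distr_deriv (0, b) (distr_of_fun w)) \<phi>)
        + distr_mult (\<lambda>(t, x). \<mu> / (1 + t)) (distr_deriv (1, 0) (distr_of_fun w)) \<phi>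
        = distr_of_fun (\<lambda>z. \<bar>w z\<bar> powr p) \<phi>)"

text \<open>
  Each \<open>u t\<close> matters only up to a null set depending on \<open>t\<close>, so \<open>(t, x) \<mapsto> u t x\<close> need not
  be jointly measurable.  The function on space-time given by the curve \<open>u\<close> is therefore a
  measurable \<open>w\<close> with \<open>w (t, \<cdot>) = u t\<close> almost everywhere; it is unique up to a null set.
\<close>

definition global_solution ::
  "real \<Rightarrow> real \<Rightarrow> ('a::euclidean_space \<Rightarrow> real) \<Rightarrow> ('a \<Rightarrow> real) \<Rightarrow> (real \<Rightarrow> 'a \<Rightarrow> real) \<Rightarrow> bool" where
  "global_solution \<mu> p u0 u1 u \<longleftrightarrow>
     continuous_curve H1 H1_norm u \<and>
     (\<exists>v. has_curve_deriv L2 L2_norm u v \<and> continuous_curve L2 L2_norm v \<and>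
          (AE x in lebesgue. v 0 x = u1 x)) \<and>
     (AE x in lebesgue. u 0 x = u0 x) \<and>
     (\<exists>w. (\<forall>t>0. AE x in lebesgue. w (t, x) = u t x) \<and> distr_solution \<mu> p w)"

end

theory Submission
  imports Defs
begin

text \<open>
  The proof is by the method of test functions with a weight.  The weight \<open>g(t) = (1 + t)\<^sup>\<mu>\<close>
  solves \<open>g' = \<mu>/(1+t) g\<close>, so multiplying the equation by \<open>g\<close> turns the damped part into a
  divergence: \<open>g (u\<^sub>t\<^sub>t + \<mu>/(1+t) u\<^sub>t) = (g u\<^sub>t)\<^sub>t\<close>.  Testing with \<open>g \<Psi>\<close>, where \<open>\<Psi>\<close> cuts off to
  the cylinder \<open>t \<lesssim> R\<close>, \<open>|x| \<lesssim> R\<close>, gives formally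

    \<open>\<integral>\<integral> |u|\<^sup>p g \<Psi> + \<integral> u\<^sub>1 = \<integral>\<integral> u X\<close>,  where  \<open>X = (g \<Psi>\<^sub>t)\<^sub>t - g \<Delta>\<Psi>\<close>.

  The function \<open>X\<close> lives on the shell where \<open>\<Psi>\<close> decays.  If \<open>\<Psi>\<close> is a high power of a smooth
  cutoff, then \<open>|X| \<le> C R\<^sup>-\<^sup>2 g \<Psi>\<^bsup>1/p\<^esup>\<close> (lemma \<open>residual_bound\<close>), and Young's inequality with
  a parameter \<open>l > 0\<close> leads to the bound of lemma \<open>test_function_inequality\<close>,

    \<open>\<integral>\<integral> |u|\<^sup>p g \<Psi> + c \<le> l \<integral>\<integral>\<^bsub>shell\<^esub> |u|\<^sup>p g \<Psi> + C l\<^bsup>-1/(p-1)\<^esup> R\<^bsup>n+1+\<mu>-2p/(p-1)\<^esup>\<close>,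

  in which \<open>c > 0\<close> is half of the integral of \<open>u\<^sub>1\<close>.  The upper bound on \<open>p\<close> says exactly that the
  exponent of \<open>R\<close> is at most \<open>0\<close> (lemma \<open>critical_scaling\<close>).  With \<open>l = 1/2\<close> the integrals on the
  left are bounded uniformly in \<open>R\<close>.  With \<open>l\<close> large the last term is at most \<open>c/2\<close>, so every
  shell carries at least a fixed amount \<open>\<delta> > 0\<close> of \<open>|u|\<^sup>p g \<Psi>\<close>.  The shells of radii \<open>4\<^sup>j R\<^sub>0\<close> are
  disjoint, hence the integrals grow at least like \<open>j \<delta>\<close>, a contradiction.  This argument covers the
  critical and the subcritical exponents at once.

  Two points need care.  Distributional solutions are tested only with functions supported in
  \<open>t > 0\<close>, so \<open>\<Psi>\<close> contains an additional factor that is switched on between \<open>t = \<epsilon>\<close> and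
  \<open>t = 2\<epsilon>\<close>.  The initial velocity is recovered from the term in which this factor is
  differentiated: there \<open>u\<close> can be integrated over \<open>x\<close> first, and the resulting function of \<open>t\<close> is
  continuously differentiable (lemma \<open>initial_layer\<close>).  Since the bounds do not depend on
  \<open>\<epsilon>\<close>, it may be chosen small for finitely many radii at a time, and no limit \<open>\<epsilon> \<rightarrow> 0\<close> is taken.
  Secondly, test functions must be smooth to all orders; they are all drawn from a class of explicit
  expressions that is closed under differentiation (\<open>elementary_smooth\<close>).
\<close>

section \<open>Smooth functions\<close>

text \<open>
  The functions \<open>e\<^bsup>-1/x\<^esup> x\<^bsup>-m\<^esup>\<close>, extended by \<open>0\<close> to the left half line.  The powers of \<open>1/x\<close>
  are included because they appear on differentiating the case \<open>m = 0\<close>: the linear span of the family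
  is closed under differentiation.
\<close>

definition flat :: "nat \<Rightarrow> real \<Rightarrow> real" where
  "flat m x = (if x > 0 then exp (- inverse x) * inverse x ^ m else 0)"

lemma flat_tendsto_0: "(flat m \<longlongrightarrow> 0) (at 0)"
proof (rule filterlim_split_at)
  show "(flat m \<longlongrightarrow> 0) (at_left 0)"
    by (rule tendsto_eventually) (auto simp: eventually_at_filter flat_def)
  have "((\<lambda>x::real. inverse x ^ m / exp (inverse x)) \<longlongrightarrow> 0) (at_right 0)"
    by (rule filterlim_compose[OF tendsto_power_div_exp_0 filterlim_inverse_at_top_right])
  then show "(flat m \<longlongrightarrow> 0) (at_right 0)"
    by (rule Lim_transform_eventually)
       (auto simp: eventually_at_filter flat_def exp_minus field_simps)
qed

lemma flat_deriv:
  "(flat m has_real_derivative flat (m + 2) x - real m * flat (m + 1) x) (at x)"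
proof -
  consider "x < 0" | "x > 0" | "x = 0" by linarith
  then show ?thesis
  proof cases
    case 1
    have "((\<lambda>_. 0) has_real_derivative 0) (at x)" by simp
    then have "(flat m has_real_derivative 0) (at x)"
      by (rule has_field_derivative_transform_within_open[where S="{..<0}"])
         (use 1 in \<open>auto simp: flat_def\<close>)
    then show ?thesis using 1 by (simp add: flat_def)
  next
    case 2
    have "((\<lambda>x. exp (- inverse x) * inverse x ^ m) has_real_derivative
            flat (m + 2) x - real m * flat (m + 1) x) (at x)"
      using 2
      by (cases m)
         (auto intro!: derivative_eq_intros simp: flat_def field_simps power_inverse power2_eq_square,
          metis One_nat_def power_eq_if)
    then show ?thesis
      by (rule has_field_derivative_transform_within_open[where S="{0<..}"])
         (use 2 in \<open>auto simp: flat_def\<close>)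
  next
    case 3
    \<comment> \<open>the difference quotient of \<open>flat m\<close> at \<open>0\<close> is \<open>flat (m + 1)\<close>\<close>
    have "((\<lambda>y. (flat m y - flat m 0) / (y - 0)) \<longlongrightarrow> 0) (at 0)"
      by (rule Lim_transform_eventually[OF flat_tendsto_0[of "Suc m"]])
         (auto simp: eventually_at_filter flat_def field_simps)
    then show ?thesis
      using 3 by (simp add: has_field_derivative_iff flat_def)
  qed
qed

lemma flat_nonneg: "flat m x \<ge> 0" and flat_pos: "x > 0 \<Longrightarrow> flat m x > 0"
  by (auto simp: flat_def)

text \<open>
  Smoothness as required of test functions speaks about all iterated derivatives, which makes closure
  properties awkward to prove directly.  Instead, the functions below form a syntactic class whose
  members are differentiable with partial derivatives in the class again; smoothness follows by one
  induction (\<open>es_C_diff\<close>).  The class contains everything needed here: real powers of positive functions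
  provide the weight \<open>(1 + t)\<^sup>\<mu>\<close> and quotients, \<open>flat\<close> provides cutoffs.
\<close>

inductive elementary_smooth :: "('a::euclidean_space \<Rightarrow> real) \<Rightarrow> bool" where
  es_const: "elementary_smooth (\<lambda>_. c)"
| es_inner: "elementary_smooth (\<lambda>x. x \<bullet> b)"
| es_add: "elementary_smooth f \<Longrightarrow> elementary_smooth g \<Longrightarrow> elementary_smooth (\<lambda>x. f x + g x)"
| es_mult: "elementary_smooth f \<Longrightarrow> elementary_smooth g \<Longrightarrow> elementary_smooth (\<lambda>x. f x * g x)"
| es_flat: "elementary_smooth f \<Longrightarrow> elementary_smooth (\<lambda>x. flat m (f x))"
| es_powr: "elementary_smooth f \<Longrightarrow> (\<And>x. f x > 0) \<Longrightarrow> elementary_smooth (\<lambda>x. f x powr a)"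

lemma es_cmult: "elementary_smooth f \<Longrightarrow> elementary_smooth (\<lambda>x. c * f x)"
  by (intro es_mult es_const)

lemma es_diff:
  "elementary_smooth f \<Longrightarrow> elementary_smooth g \<Longrightarrow> elementary_smooth (\<lambda>x. f x - g x)"
  using es_add[of f "\<lambda>x. -1 * g x"] es_cmult[of g "-1"] by simp

lemma es_power: "elementary_smooth f \<Longrightarrow> elementary_smooth (\<lambda>x. f x ^ k)"
  by (induction k) (auto intro: es_const es_mult)

lemma es_sum: "(\<And>i. i \<in> I \<Longrightarrow> elementary_smooth (f i)) \<Longrightarrow> elementary_smooth (\<lambda>x. \<Sum>i\<in>I. f i x)"
  by (induction I rule: infinite_finite_induct) (auto intro: es_const es_add)

lemma es_id: "elementary_smooth (\<lambda>x::real. x)"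
  using es_inner[of "1::real"] by simp

lemma es_divide:
  assumes "elementary_smooth f" "elementary_smooth g" "\<And>x. g x > 0"
  shows "elementary_smooth (\<lambda>x. f x / g x)"
proof -
  have "elementary_smooth (\<lambda>x. f x * g x powr (-1))"
    using assms by (intro es_mult es_powr)
  moreover have "(\<lambda>x. f x * g x powr (-1)) = (\<lambda>x. f x / g x)"
    using assms(3) by (auto simp: powr_minus divide_inverse powr_one less_imp_le)
  ultimately show ?thesis by simp
qed

lemma es_compose:
  assumes "elementary_smooth h" "elementary_smooth q"
  shows "elementary_smooth (\<lambda>x. h (q x :: real))"
  using assms(1)
proof induction
  case (es_inner b)
  show ?case using es_cmult[OF assms(2), of b] by (simp add: mult.commute)
qed (auto intro: elementary_smooth.intros)

lemma es_fst: "elementary_smooth h \<Longrightarrow> elementary_smooth (\<lambda>z. h (fst z))"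
proof (induction rule: elementary_smooth.induct)
  case (es_inner b)
  have "(\<lambda>z::'a \<times> 'b. fst z \<bullet> b) = (\<lambda>z. z \<bullet> (b, 0))" by (auto simp: inner_prod_def)
  then show ?case by (simp only: elementary_smooth.es_inner)
qed (auto intro: elementary_smooth.intros)

lemma es_snd: "elementary_smooth h \<Longrightarrow> elementary_smooth (\<lambda>z. h (snd z))"
proof (induction rule: elementary_smooth.induct)
  case (es_inner b)
  have "(\<lambda>z::'b \<times> 'a. snd z \<bullet> b) = (\<lambda>z. z \<bullet> (0, b))" by (auto simp: inner_prod_def)
  then show ?case by (simp only: elementary_smooth.es_inner)
qed (auto intro: elementary_smooth.intros)

lemma es_has_derivative:
  assumes "elementary_smooth f"
  shows "\<exists>D. (\<forall>x. (f has_derivative D x) (at x)) \<and> (\<forall>b. elementary_smooth (\<lambda>x. D x b))"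
  using assms
proof induction
  case (es_const c)
  show ?case by (rule exI[of _ "\<lambda>_ _. 0"]) (auto intro: elementary_smooth.es_const)
next
  case (es_inner b)
  show ?case
    by (rule exI[of _ "\<lambda>_ h. h \<bullet> b"])
       (auto intro!: elementary_smooth.es_const derivative_eq_intros)
next
  case (es_add f g)
  then obtain Df Dg where
    "\<forall>x. (f has_derivative Df x) (at x)" "\<forall>b. elementary_smooth (\<lambda>x. Df x b)"
    "\<forall>x. (g has_derivative Dg x) (at x)" "\<forall>b. elementary_smooth (\<lambda>x. Dg x b)" by blast
  then show ?case
    by (intro exI[of _ "\<lambda>x h. Df x h + Dg x h"])
       (auto intro!: elementary_smooth.es_add has_derivative_add)
next
  case (es_mult f g)
  then obtain Df Dg where
    "\<forall>x. (f has_derivative Df x) (at x)" "\<forall>b. elementary_smooth (\<lambda>x. Df x b)"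
    "\<forall>x. (g has_derivative Dg x) (at x)" "\<forall>b. elementary_smooth (\<lambda>x. Dg x b)" by blast
  then show ?case using es_mult.hyps
    by (intro exI[of _ "\<lambda>x h. f x * Dg x h + Df x h * g x"])
       (auto intro!: elementary_smooth.es_add elementary_smooth.es_mult has_derivative_mult)
next
  case (es_flat f m)
  then obtain D where D:
    "\<And>x. (f has_derivative D x) (at x)" "\<And>b. elementary_smooth (\<lambda>x. D x b)" by blast
  have "((\<lambda>x. flat m (f x)) has_derivative
          (\<lambda>h. (flat (m + 2) (f x) - real m * flat (m + 1) (f x)) * D x h)) (at x)" for x
    using has_derivative_compose[OF D(1) flat_deriv[unfolded has_field_derivative_def]] .
  then show ?case using D es_flat.hyps
    by (intro exI[of _ "\<lambda>x h. (flat (m + 2) (f x) - real m * flat (m + 1) (f x)) * D x h"] conjI allI)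
       (auto intro!: elementary_smooth.es_mult es_diff es_cmult elementary_smooth.es_flat)
next
  case (es_powr f a)
  then obtain D where D:
    "\<And>x. (f has_derivative D x) (at x)" "\<And>b. elementary_smooth (\<lambda>x. D x b)" by blast
  have "((\<lambda>x. f x powr a) has_derivative (\<lambda>h. (a * f x powr (a - 1)) * D x h)) (at x)" for x
    using has_derivative_compose[OF D(1)
        has_real_derivative_powr[OF es_powr.hyps(2), unfolded has_field_derivative_def]] .
  then show ?case using D es_powr.hyps
    by (intro exI[of _ "\<lambda>x h. (a * f x powr (a - 1)) * D x h"] conjI allI)
       (auto intro!: elementary_smooth.es_mult es_cmult elementary_smooth.es_powr)
qed

lemma es_frechet_derivative:
  assumes "elementary_smooth f"
  shows "f differentiable (at x)"
    and "elementary_smooth (\<lambda>x. frechet_derivative f (at x) b)"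
proof -
  obtain D where D: "\<And>x. (f has_derivative D x) (at x)" "\<And>b. elementary_smooth (\<lambda>x. D x b)"
    using es_has_derivative[OF assms] by blast
  then have "frechet_derivative f (at x) = D x" for x
    using frechet_derivative_at[OF D(1)[of x]] by simp
  then show "elementary_smooth (\<lambda>x. frechet_derivative f (at x) b)" using D by simp
  show "f differentiable (at x)" using D by (auto simp: differentiable_def)
qed

lemma es_continuous: 
  assumes "elementary_smooth f" shows "continuous_on S f"
proof (rule continuous_at_imp_continuous_on, rule ballI)
  show "isCont f x" for x
    using differentiable_imp_continuous_within[OF es_frechet_derivative(1)[OF assms, of x]] .
qed

lemma es_C_diff: "elementary_smooth f \<Longrightarrow> C_diff k f"
proof (induction k arbitrary: f)
  case 0
  then show ?case by (simp add: es_continuous)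
next
  case (Suc k)
  then show ?case using es_frechet_derivative by (simp only: C_diff.simps) blast
qed

lemma es_real_derivative:
  fixes f :: "real \<Rightarrow> real"
  assumes "elementary_smooth f"
  shows "\<exists>f'. elementary_smooth f' \<and> (\<forall>x. (f has_real_derivative f' x) (at x))"
proof -
  obtain D where D: "\<And>x. (f has_derivative D x) (at x)" "\<And>b. elementary_smooth (\<lambda>x. D x b)"
    using es_has_derivative[OF assms] by blast
  have "D x = (*) (D x 1)" for x
  proof
    show "D x h = D x 1 * h" for h
      by (rule trans[OF linear_scale[OF has_derivative_linear[OF D(1)[of x]], of h 1, simplified real_scaleR_def mult_1_right] mult.commute])
  qed
  then have "(f has_real_derivative D x 1) (at x)" for x
    using D(1)[of x] unfolding has_field_derivative_def by simp
  then show ?thesis using D(2) by blast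
qed

section \<open>Cutoff functions\<close>

definition smooth_step :: "real \<Rightarrow> real" where
  "smooth_step x = flat 0 x / (flat 0 x + flat 0 (1 - x))"

lemma smooth_step_denom_pos: "flat 0 x + flat 0 (1 - x) > 0"
  using flat_nonneg[of 0 x] flat_nonneg[of 0 "1 - x"] flat_pos[of x 0] flat_pos[of "1 - x" 0]
  by (cases "x > 0") auto

lemma es_smooth_step: "elementary_smooth smooth_step"
proof -
  have "elementary_smooth (\<lambda>x. flat 0 x / (flat 0 x + flat 0 (1 - x)))"
    by (intro es_divide es_add es_flat es_diff es_const es_id smooth_step_denom_pos)
  then show ?thesis by (simp add: smooth_step_def[abs_def])
qed

lemma smooth_step_eq_0: "x \<le> 0 \<Longrightarrow> smooth_step x = 0"
  and smooth_step_eq_1: "x \<ge> 1 \<Longrightarrow> smooth_step x = 1"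
  by (auto simp: smooth_step_def flat_def)

lemma smooth_step_bounds: "0 \<le> smooth_step x" "smooth_step x \<le> 1"
  using smooth_step_denom_pos[of x] flat_nonneg[of 0 x] flat_nonneg[of 0 "1 - x"]
  by (auto simp: smooth_step_def divide_le_eq)

lemma flat_0_mono: "x \<le> y \<Longrightarrow> flat 0 x \<le> flat 0 y"
  by (auto simp: flat_def le_imp_inverse_le)

lemma smooth_step_mono: "x \<le> y \<Longrightarrow> smooth_step x \<le> smooth_step y"
proof -
  assume "x \<le> y"
  then have "flat 0 x * flat 0 (1 - y) \<le> flat 0 y * flat 0 (1 - x)"
    by (intro mult_mono flat_0_mono flat_nonneg) auto
  then show ?thesis
    unfolding smooth_step_def using smooth_step_denom_pos[of x] smooth_step_denom_pos[of y]
    by (simp add: divide_le_eq pos_le_divide_eq field_simps)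
qed

text \<open>
  Constancy of \<open>f\<close> on the open half lines determines \<open>f'\<close> there; nothing is claimed at the end points
  \<open>a\<close> and \<open>b\<close>.
\<close>

lemma deriv_zero_outside:
  fixes f f' :: "real \<Rightarrow> real"
  assumes "\<And>x. (f has_real_derivative f' x) (at x)"
    and "\<And>x. x < a \<Longrightarrow> f x = c" "\<And>x. x > b \<Longrightarrow> f x = d" "x < a \<or> x > b"
  shows "f' x = 0"
proof -
  have "(f has_real_derivative 0) (at x)"
  proof (cases "x < a")
    case True
    show ?thesis
      by (rule has_field_derivative_transform_within_open[of "\<lambda>_. c" _ _ "{..<a}"])
         (use True assms(2) in auto)
  next
    case False
    then have "x > b" using assms(4) by auto
    show ?thesis
      by (rule has_field_derivative_transform_within_open[of "\<lambda>_. d" _ _ "{b<..}"])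
         (use \<open>x > b\<close> assms(3) in auto)
  qed
  then show ?thesis using DERIV_unique[OF assms(1)[of x]] by simp
qed

lemma bounded_if_supported:
  fixes f :: "real \<Rightarrow> real"
  assumes "continuous_on {a..b} f" "\<And>x. x < a \<or> x > b \<Longrightarrow> f x = 0"
  shows "\<exists>N\<ge>0. \<forall>x. \<bar>f x\<bar> \<le> N"
proof -
  have "bounded (f ` {a..b})"
    using assms(1) by (intro compact_imp_bounded compact_continuous_image) auto
  then obtain N where "\<forall>y\<in>f ` {a..b}. norm y \<le> N" by (auto simp: bounded_iff)
  then have "\<bar>f x\<bar> \<le> max N 0" for x
    using assms(2)[of x] by (cases "x \<in> {a..b}") (auto simp: le_max_iff_disj)
  then show ?thesis by (intro exI[of _ "max N 0"]) auto
qed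

text \<open>
  A smooth cutoff \<open>S\<close> of the half line whose first two derivatives are dominated by a power \<open>S\<^sup>r\<close> with
  \<open>r < 1\<close>.  For \<open>r = 1/p\<close> this domination is what allows the error terms of the test function method to
  be absorbed into \<open>|w|\<^sup>p S\<close> by Young's inequality.
\<close>

locale cutoff =
  fixes r :: real and S S' S'' :: "real \<Rightarrow> real" and M :: real
  assumes r: "0 < r" "r < 1"
    and es_S: "elementary_smooth S" "elementary_smooth S'" "elementary_smooth S''"
    and deriv_S: "\<And>s. (S has_real_derivative S' s) (at s)" "\<And>s. (S' has_real_derivative S'' s) (at s)"
    and S_bounds: "\<And>s. 0 \<le> S s" "\<And>s. S s \<le> 1"
    and S_eq: "\<And>s. s \<le> 1 \<Longrightarrow> S s = 1" "\<And>s. 2 \<le> s \<Longrightarrow> S s = 0"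
    and S'_eq_0: "\<And>s. s < 1 \<or> 2 < s \<Longrightarrow> S' s = 0" "\<And>s. s < 1 \<or> 2 < s \<Longrightarrow> S'' s = 0"
    and M: "0 \<le> M" "\<And>s. \<bar>S' s\<bar> \<le> M * S s powr r" "\<And>s. \<bar>S'' s\<bar> \<le> M * S s powr r"

text \<open>
  Take \<open>S = \<sigma>\<^sup>k\<close> for an ordinary cutoff \<open>\<sigma>\<close>.  Two differentiations lower the power of \<open>\<sigma>\<close> by two, and
  \<open>\<sigma>\<^bsup>k-2\<^esup> \<le> \<sigma>\<^bsup>kr\<^esup>\<close> as soon as \<open>k (1 - r) \<ge> 2\<close>.
\<close>

lemma cutoff_exists:
  fixes r :: real
  assumes r: "0 < r" "r < 1"
  shows "\<exists>S S' S'' M. cutoff r S S' S'' M"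
proof -
  define \<sigma> where "\<sigma> s = smooth_step (2 - s)" for s
  have es\<sigma>: "elementary_smooth \<sigma>"
    unfolding \<sigma>_def[abs_def] by (intro es_compose[OF es_smooth_step] es_diff es_const es_id)
  have \<sigma>1: "\<sigma> s = 1" if "s \<le> 1" for s using that by (simp add: \<sigma>_def smooth_step_eq_1)
  have \<sigma>0: "\<sigma> s = 0" if "s \<ge> 2" for s using that by (simp add: \<sigma>_def smooth_step_eq_0)
  have \<sigma>b: "0 \<le> \<sigma> s" "\<sigma> s \<le> 1" for s using smooth_step_bounds by (auto simp: \<sigma>_def)
  obtain \<sigma>' where \<sigma>': "elementary_smooth \<sigma>'" "\<And>x. (\<sigma> has_real_derivative \<sigma>' x) (at x)"
    using es_real_derivative[OF es\<sigma>] by blast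
  obtain \<sigma>'' where \<sigma>'': "elementary_smooth \<sigma>''" "\<And>x. (\<sigma>' has_real_derivative \<sigma>'' x) (at x)"
    using es_real_derivative[OF \<sigma>'(1)] by blast
  have z1: "\<sigma>' s = 0" if "s < 1 \<or> s > 2" for s
    by (rule deriv_zero_outside[OF \<sigma>'(2), of 1 1 2 0]) (use \<sigma>1 \<sigma>0 that in auto)
  have z2: "\<sigma>'' s = 0" if "s < 1 \<or> s > 2" for s
    by (rule deriv_zero_outside[OF \<sigma>''(2), of 1 0 2 0]) (use z1 that in auto)
  obtain N1 where N1: "N1 \<ge> 0" "\<And>s. \<bar>\<sigma>' s\<bar> \<le> N1"
    using bounded_if_supported[OF es_continuous[OF \<sigma>'(1)] z1] by blast
  obtain N2 where N2: "N2 \<ge> 0" "\<And>s. \<bar>\<sigma>'' s\<bar> \<le> N2"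
    using bounded_if_supported[OF es_continuous[OF \<sigma>''(1)] z2] by blast
  obtain m :: nat where m: "real m \<ge> 3 / (1 - r)" using real_arch_simple by blast
  define k where "k = m + 3"
  have k: "real k * r \<le> real k - 2" "k \<ge> 3"
  proof -
    have "3 \<le> real m * (1 - r)" using m r by (simp add: pos_divide_le_eq)
    moreover have "0 \<le> 3 * (1 - r)" using r by simp
    ultimately show "real k * r \<le> real k - 2" by (simp add: k_def algebra_simps)
  qed (simp add: k_def)
  define S where "S s = \<sigma> s ^ k" for s
  define S' where "S' s = real k * \<sigma> s ^ (k - 1) * \<sigma>' s" for s
  define S'' where "S'' s = real k * (real (k - 1) * \<sigma> s ^ (k - 2) * \<sigma>' s * \<sigma>' s + \<sigma> s ^ (k - 1) * \<sigma>'' s)" for s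
  define M where "M = real k * (real (k - 1) * N1 * N1 + N2 + N1)"
  have key: "\<sigma> s ^ (k - 2) \<le> S s powr r" for s
  proof (cases "\<sigma> s = 0")
    case False
    then have p: "\<sigma> s > 0" using \<sigma>b[of s] by auto
    have "\<sigma> s ^ (k - 2) = \<sigma> s powr (real k - 2)"
      using p k by (simp add: powr_realpow[symmetric] of_nat_diff)
    also have "\<dots> \<le> \<sigma> s powr (real k * r)"
      using p \<sigma>b[of s] k(1) by (intro powr_mono') auto
    also have "\<dots> = S s powr r"
      using p by (simp add: S_def powr_realpow[symmetric] powr_powr)
    finally show ?thesis .
  qed (use k in \<open>simp add: zero_power\<close>)
  have key': "\<sigma> s ^ (k - 1) \<le> \<sigma> s ^ (k - 2)" for s
    using \<sigma>b[of s] by (intro power_decreasing) auto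
  have pn: "0 \<le> \<sigma> s ^ j" for s j using \<sigma>b by simp
  have "cutoff r S S' S'' M"
  proof
    show "0 < r" "r < 1" by (rule r)+
    show "elementary_smooth S" "elementary_smooth S'" "elementary_smooth S''"
      unfolding S_def[abs_def] S'_def[abs_def] S''_def[abs_def]
      by (intro es_mult es_add es_const es_power es\<sigma> \<sigma>'(1) \<sigma>''(1))+
    show "(S has_real_derivative S' s) (at s)" for s
      unfolding S_def[abs_def] S'_def
      by (auto intro!: derivative_eq_intros \<sigma>'(2))
    show "(S' has_real_derivative S'' s) (at s)" for s
      unfolding S'_def[abs_def] S''_def
      by (auto intro!: derivative_eq_intros \<sigma>'(2) \<sigma>''(2) simp: algebra_simps numeral_2_eq_2)
    show "0 \<le> S s" "S s \<le> 1" for s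
      using \<sigma>b[of s] by (auto simp: S_def power_le_one)
    show "S s = 1" if "s \<le> 1" for s using \<sigma>1[OF that] by (simp add: S_def)
    show "S s = 0" if "2 \<le> s" for s using \<sigma>0[OF that] k by (simp add: S_def)
    show "S' s = 0" "S'' s = 0" if "s < 1 \<or> 2 < s" for s
      using z1[OF that] z2[OF that] by (auto simp: S'_def S''_def)
    show "0 \<le> M" using N1 N2 by (simp add: M_def)
    have P: "\<sigma> s ^ (k - 1) \<le> S s powr r" for s using key key' order_trans by blast
    show "\<bar>S' s\<bar> \<le> M * S s powr r" for s
    proof -
      have "\<bar>S' s\<bar> \<le> real k * S s powr r * N1"
        unfolding S'_def abs_mult using P[of s] N1 pn[of s "k - 1"]
        by (intro mult_mono) auto
      also have "\<dots> \<le> M * S s powr r"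
        using N1 N2 unfolding M_def by (simp add: algebra_simps)
      finally show ?thesis .
    qed
    show "\<bar>S'' s\<bar> \<le> M * S s powr r" for s
    proof -
      have "\<bar>S'' s\<bar> \<le> real k * (real (k - 1) * S s powr r * N1 * N1 + S s powr r * N2)"
        unfolding S''_def abs_mult using P[of s] key[of s] N1 N2 pn[of s]
        by (intro mult_mono order_trans[OF abs_triangle_ineq] add_mono)
           (auto simp: abs_mult intro!: mult_mono)
      also have "\<dots> \<le> M * S s powr r"
        using N1 N2 unfolding M_def by (simp add: algebra_simps)
      finally show ?thesis .
    qed
  qed
  then show ?thesis by blast
qed

section \<open>Integration\<close>

lemma integrable_continuous_supported:
  fixes f :: "'a::euclidean_space \<Rightarrow> real"
  assumes "continuous_on UNIV f" "compact K" "\<And>x. x \<notin> K \<Longrightarrow> f x = 0"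
  shows "integrable lebesgue f"
proof -
  have "set_integrable lborel K f"
    unfolding set_integrable_def
    using assms(1,2) by (intro borel_integrable_compact) (auto intro: continuous_on_subset)
  moreover have "(\<lambda>x. indicator K x *\<^sub>R f x) = f"
    using assms(3) by (auto split: split_indicator)
  ultimately have "integrable lborel f" by (simp add: set_integrable_def)
  moreover have "f \<in> borel_measurable lborel"
    using borel_measurable_continuous_onI[OF assms(1)] by simp
  ultimately show ?thesis by (simp add: integrable_completion)
qed

lemma integrable_locally_integrable_mult:
  fixes w \<psi> :: "'a::euclidean_space \<Rightarrow> real"
  assumes "locally_integrable_on w \<Omega>" "compact K" "K \<subseteq> \<Omega>"
    and "continuous_on UNIV \<psi>" "\<And>x. x \<notin> K \<Longrightarrow> \<psi> x = 0"
  shows "integrable lebesgue (\<lambda>x. w x * \<psi> x)"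
proof -
  have i: "integrable lebesgue (\<lambda>x. indicator K x *\<^sub>R w x)"
    using assms(1-3) by (auto simp: locally_integrable_on_def set_integrable_def)
  have "bounded (\<psi> ` K)"
    using assms(2,4) by (intro compact_imp_bounded compact_continuous_image)
      (auto intro: continuous_on_subset)
  then obtain C where C: "\<And>x. x \<in> K \<Longrightarrow> \<bar>\<psi> x\<bar> \<le> C" by (auto simp: bounded_iff)
  have "integrable lebesgue (\<lambda>x. (indicator K x *\<^sub>R w x) * \<psi> x)"
  proof (rule Bochner_Integration.integrable_bound)
    show "integrable lebesgue (\<lambda>x. C * (indicator K x *\<^sub>R w x))"
      using i by (rule integrable_mult_right)
    have "\<psi> \<in> borel_measurable lebesgue"
      using borel_measurable_continuous_onI[OF assms(4)] by (simp add: measurable_completion)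
    then show "(\<lambda>x. (indicator K x *\<^sub>R w x) * \<psi> x) \<in> borel_measurable lebesgue"
      using borel_measurable_integrable[OF i] by measurable
    show "AE x in lebesgue. norm (indicator K x *\<^sub>R w x * \<psi> x) \<le> norm (C * (indicator K x *\<^sub>R w x))"
    proof (rule AE_I2)
      fix x
      show "norm (indicator K x *\<^sub>R w x * \<psi> x) \<le> norm (C * (indicator K x *\<^sub>R w x))"
      proof (cases "x \<in> K")
        case True
        then have "\<bar>\<psi> x\<bar> \<le> \<bar>C\<bar>" using C[OF True] by linarith
        then have "\<bar>w x\<bar> * \<bar>\<psi> x\<bar> \<le> \<bar>w x\<bar> * \<bar>C\<bar>" by (rule mult_left_mono) simp
        then show ?thesis using True by (simp add: abs_mult mult.commute)
      qed simp
    qed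
  qed
  moreover have "(\<lambda>x. (indicator K x *\<^sub>R w x) * \<psi> x) = (\<lambda>x. w x * \<psi> x)"
    using assms(5) by (auto split: split_indicator)
  ultimately show ?thesis by simp
qed

text \<open>
  Fubini's theorem for the completed measure.  The function \<open>f\<close> need not be Borel, and its slices are
  only prescribed up to null sets by functions \<open>k t\<close>; measurability of the inner integral in \<open>t\<close> is
  therefore an assumption.  The proof replaces \<open>f\<close> by a Borel function equal to it almost everywhere.
\<close>

lemma integral_lebesgue_iterated:
  fixes f :: "'a::euclidean_space \<times> 'b::euclidean_space \<Rightarrow> real"
  assumes f: "integrable lebesgue f"
    and k: "\<And>t. AE x in lebesgue. f (t, x) = k t x" "\<And>t. k t \<in> borel_measurable lebesgue"
    and h: "(\<lambda>t. LINT x|lebesgue. k t x) \<in> borel_measurable borel"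
  shows "(LINT z|lebesgue. f z) = (LINT t|lborel. LINT x|lebesgue. k t x)"
proof -
  obtain f' where f': "f' \<in> borel_measurable lborel" "AE z in lborel. f z = f' z"
    using completion_ex_borel_measurable_real[OF borel_measurable_integrable[OF f]] by auto
  have ae: "AE z in lebesgue. f z = f' z" using f'(2) by (rule AE_completion)
  have m: "f' \<in> borel_measurable lebesgue" using f'(1) by (rule measurable_completion)
  have "integrable lebesgue f'"
    using integrable_cong_AE[OF borel_measurable_integrable[OF f] m ae] f by simp
  then have i: "integrable lborel f'" using f'(1) by (simp add: integrable_completion)
  have i2: "integrable (lborel \<Otimes>\<^sub>M lborel) f'" using i by (simp add: lborel_prod)
  have "(LINT z|lebesgue. f z) = (LINT z|lebesgue. f' z)"
    by (rule integral_cong_AE[OF borel_measurable_integrable[OF f] m ae])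
  also have "\<dots> = (LINT z|lborel. f' z)" using f'(1) by (simp add: integral_completion)
  also have "\<dots> = integral\<^sup>L (lborel \<Otimes>\<^sub>M lborel) f'" by (simp add: lborel_prod)
  also have "\<dots> = (LINT t|lborel. LINT x|lborel. f' (t, x))"
    by (rule lborel_pair.integral_fst'[OF i2, symmetric])
  also have "\<dots> = (LINT t|lborel. LINT x|lebesgue. k t x)"
  proof (rule integral_cong_AE)
    show "(\<lambda>t. LINT x|lborel. f' (t, x)) \<in> borel_measurable lborel"
      using lborel_pair.integrable_fst'[OF i2] by (rule borel_measurable_integrable)
    show "(\<lambda>t. LINT x|lebesgue. k t x) \<in> borel_measurable lborel" using h by simp
    have "AE z in lborel \<Otimes>\<^sub>M lborel. f z = f' z"
      unfolding lborel_prod by (rule f'(2))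
    then have "AE t in lborel. AE x in lborel. f (t, x) = f' (t, x)"
      by (rule lborel_pair.AE_pair)
    then show "AE t in lborel. (LINT x|lborel. f' (t, x)) = (LINT x|lebesgue. k t x)"
    proof (eventually_elim)
      fix t assume a: "AE x in lborel. f (t, x) = f' (t, x)"
      have mt: "(\<lambda>x. f' (t, x)) \<in> borel_measurable lborel"
        using f'(1) by (simp add: borel_prod[symmetric])
      have "(LINT x|lborel. f' (t, x)) = (LINT x|lebesgue. f' (t, x))"
        using mt by (simp add: integral_completion)
      also have "\<dots> = (LINT x|lebesgue. k t x)"
      proof (rule integral_cong_AE[OF measurable_completion[OF mt] k(2)])
        show "AE x in lebesgue. f' (t, x) = k t x"
          using AE_completion[OF a] k(1)[of t] by eventually_elim simp
      qed
      finally show "(LINT x|lborel. f' (t, x)) = (LINT x|lebesgue. k t x)" .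
    qed
  qed
  finally show ?thesis .
qed

lemma L2_mult:
  assumes f: "f \<in> L2" and g: "g \<in> L2"
  shows "integrable lebesgue (\<lambda>x. f x * g x)"
    and "\<bar>LINT x|lebesgue. f x * g x\<bar> \<le> L2_norm f * L2_norm g"
proof -
  have mf: "f \<in> borel_measurable lebesgue" "g \<in> borel_measurable lebesgue"
    and i2: "integrable lebesgue (\<lambda>x. (f x)\<^sup>2)" "integrable lebesgue (\<lambda>x. (g x)\<^sup>2)"
    using f g by (auto simp: L2_def)
  show i: "integrable lebesgue (\<lambda>x. f x * g x)"
  proof (rule Bochner_Integration.integrable_bound)
    show "integrable lebesgue (\<lambda>x. (f x)\<^sup>2 + (g x)\<^sup>2)" using i2 by simp
    show "(\<lambda>x. f x * g x) \<in> borel_measurable lebesgue" using mf by measurable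
    show "AE x in lebesgue. norm (f x * g x) \<le> norm ((f x)\<^sup>2 + (g x)\<^sup>2)"
    proof (rule AE_I2)
      fix x
      have "0 \<le> (\<bar>f x\<bar> - \<bar>g x\<bar>)\<^sup>2" by simp
      then have "2 * (\<bar>f x\<bar> * \<bar>g x\<bar>) \<le> (f x)\<^sup>2 + (g x)\<^sup>2"
        by (simp add: power2_diff)
      then show "norm (f x * g x) \<le> norm ((f x)\<^sup>2 + (g x)\<^sup>2)"
        unfolding real_norm_def abs_mult by (smt (verit) mult_nonneg_nonneg abs_ge_zero)
    qed
  qed
  define A B P where "A = (LINT x|lebesgue. (f x)\<^sup>2)" and "B = (LINT x|lebesgue. (g x)\<^sup>2)"
    and "P = (LINT x|lebesgue. f x * g x)"
  have AB: "0 \<le> A" "0 \<le> B" by (auto simp: A_def B_def)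
  \<comment> \<open>Cauchy-Schwarz by the discriminant of \<open>s \<mapsto> \<parallel>f + s g\<parallel>\<^sup>2\<close>\<close>
  have q: "0 \<le> A + 2 * s * P + s\<^sup>2 * B" for s
  proof -
    have "0 \<le> (LINT x|lebesgue. (f x + s * g x)\<^sup>2)" by simp
    also have "(LINT x|lebesgue. (f x + s * g x)\<^sup>2)
      = (LINT x|lebesgue. (f x)\<^sup>2 + 2 * s * (f x * g x) + s\<^sup>2 * (g x)\<^sup>2)"
      by (simp add: power2_sum power_mult_distrib algebra_simps)
    also have "\<dots> = A + 2 * s * P + s\<^sup>2 * B"
      using i i2 by (simp add: A_def B_def P_def)
    finally show ?thesis .
  qed
  have "P\<^sup>2 \<le> A * B"
  proof (cases "B = 0")
    case True
    have "P = 0"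
    proof (rule ccontr)
      assume "P \<noteq> 0"
      then have "2 * (- (A + 1) / P) * P = - 2 * (A + 1)" by simp
      then show False using q[of "- (A + 1) / P"] True AB by simp
    qed
    then show ?thesis using AB by simp
  next
    case False
    then show ?thesis using q[of "- P / B"] AB
      by (simp add: field_simps power2_eq_square)
  qed
  then have "\<bar>P\<bar> \<le> sqrt (A * B)" by (simp add: real_le_rsqrt real_sqrt_abs[symmetric] del: real_sqrt_abs)
  then show "\<bar>LINT x|lebesgue. f x * g x\<bar> \<le> L2_norm f * L2_norm g"
    by (simp add: P_def A_def B_def L2_norm_def real_sqrt_mult)
qed

lemma L2_diff: "f \<in> L2 \<Longrightarrow> g \<in> L2 \<Longrightarrow> (\<lambda>x. f x - g x) \<in> L2"
proof -
  assume f: "f \<in> L2" and g: "g \<in> L2"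
  then have "integrable lebesgue (\<lambda>x. (f x)\<^sup>2 - 2 * (f x * g x) + (g x)\<^sup>2)"
    using L2_mult(1)[OF f g] by (auto simp: L2_def)
  also have "(\<lambda>x. (f x)\<^sup>2 - 2 * (f x * g x) + (g x)\<^sup>2) = (\<lambda>x. (f x - g x)\<^sup>2)"
    by (auto simp: power2_diff)
  finally show ?thesis using f g by (auto simp: L2_def)
qed

lemma L2_divide: "f \<in> L2 \<Longrightarrow> (\<lambda>x. f x / c) \<in> L2"
  by (auto simp: L2_def power_divide)

lemma L2_pairing_tendsto:
  assumes "((\<lambda>s. L2_norm (F s)) \<longlongrightarrow> 0) G" "\<beta> \<in> L2" "\<forall>\<^sub>F s in G. F s \<in> L2"
  shows "((\<lambda>s. LINT x|lebesgue. F s x * \<beta> x) \<longlongrightarrow> 0) G"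
proof (rule Lim_null_comparison)
  show "\<forall>\<^sub>F s in G. norm (LINT x|lebesgue. F s x * \<beta> x) \<le> L2_norm (F s) * L2_norm \<beta>"
    using assms(3) by eventually_elim (use L2_mult(2)[OF _ assms(2)] in auto)
  show "((\<lambda>s. L2_norm (F s) * L2_norm \<beta>) \<longlongrightarrow> 0) G"
    using tendsto_mult_left_zero[OF assms(1)] .
qed

text \<open>
  Pairing with a fixed \<open>\<beta> \<in> L\<^sup>2\<close> is a bounded functional, so it turns curves in \<open>L\<^sup>2\<close> that are
  continuous or differentiable in norm into scalar functions with the same regularity.
\<close>

lemma curve_pairing_continuous:
  assumes "continuous_curve L2 L2_norm v" and \<beta>: "\<beta> \<in> L2"
  shows "continuous_on {0..} (\<lambda>t. LINT x|lebesgue. v t x * \<beta> x)"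
  unfolding continuous_on_def
proof (rule ballI)
  fix t :: real assume "t \<in> {0..}"
  then have v: "\<And>s. s \<ge> 0 \<Longrightarrow> v s \<in> L2" "t \<ge> 0"
    "((\<lambda>s. L2_norm (\<lambda>x. v s x - v t x)) \<longlongrightarrow> 0) (at t within {0..})"
    using assms(1) by (auto simp: continuous_curve_def)
  have e: "\<forall>\<^sub>F s in at t within {0..}. s \<ge> 0" by (simp add: eventually_at_filter)
  have "((\<lambda>s. LINT x|lebesgue. (v s x - v t x) * \<beta> x) \<longlongrightarrow> 0) (at t within {0..})"
    by (rule L2_pairing_tendsto[OF v(3) \<beta>])
       (use e in eventually_elim, use v in \<open>auto intro: L2_diff\<close>)
  moreover have "\<forall>\<^sub>F s in at t within {0..}. (LINT x|lebesgue. (v s x - v t x) * \<beta> x) =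
      (LINT x|lebesgue. v s x * \<beta> x) - (LINT x|lebesgue. v t x * \<beta> x)"
    using e by eventually_elim (use v L2_mult(1)[OF _ \<beta>] in \<open>simp add: left_diff_distrib\<close>)
  ultimately have "((\<lambda>s. (LINT x|lebesgue. v s x * \<beta> x) - (LINT x|lebesgue. v t x * \<beta> x)) \<longlongrightarrow> 0)
      (at t within {0..})"
    by (rule Lim_transform_eventually)
  then show "((\<lambda>t. LINT x|lebesgue. v t x * \<beta> x) \<longlongrightarrow> (LINT x|lebesgue. v t x * \<beta> x))
      (at t within {0..})"
    by (rule Lim_null[THEN iffD2])
qed

lemma curve_pairing_deriv:
  assumes "has_curve_deriv L2 L2_norm u v" and \<beta>: "\<beta> \<in> L2" and t: "t \<ge> 0"
  shows "((\<lambda>t. LINT x|lebesgue. u t x * \<beta> x) has_real_derivative (LINT x|lebesgue. v t x * \<beta> x))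
           (at t within {0..})"
proof -
  have u: "\<And>s. s \<ge> 0 \<Longrightarrow> u s \<in> L2" "v t \<in> L2"
    "((\<lambda>s. L2_norm (\<lambda>x. (u s x - u t x) / (s - t) - v t x)) \<longlongrightarrow> 0) (at t within {0..})"
    using assms(1) t by (auto simp: has_curve_deriv_def)
  have e: "\<forall>\<^sub>F s in at t within {0..}. s \<ge> 0" by (simp add: eventually_at_filter)
  have "((\<lambda>s. LINT x|lebesgue. ((u s x - u t x) / (s - t) - v t x) * \<beta> x) \<longlongrightarrow> 0) (at t within {0..})"
    by (rule L2_pairing_tendsto[OF u(3) \<beta>])
       (use e in eventually_elim, use u t in \<open>auto intro!: L2_diff L2_divide\<close>)
  moreover have "\<forall>\<^sub>F s in at t within {0..}.
      (LINT x|lebesgue. ((u s x - u t x) / (s - t) - v t x) * \<beta> x) =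
      ((LINT x|lebesgue. u s x * \<beta> x) - (LINT x|lebesgue. u t x * \<beta> x)) / (s - t)
        - (LINT x|lebesgue. v t x * \<beta> x)"
    using e
  proof eventually_elim
    fix s :: real assume "s \<ge> 0"
    then have i: "integrable lebesgue (\<lambda>x. u s x * \<beta> x)" "integrable lebesgue (\<lambda>x. u t x * \<beta> x)"
        "integrable lebesgue (\<lambda>x. v t x * \<beta> x)"
      using u t L2_mult(1)[OF _ \<beta>] by auto
    have "(LINT x|lebesgue. ((u s x - u t x) / (s - t) - v t x) * \<beta> x)
        = (LINT x|lebesgue. (u s x * \<beta> x - u t x * \<beta> x) / (s - t) - v t x * \<beta> x)"
      by (simp add: left_diff_distrib diff_divide_distrib)
    also have "\<dots> = (LINT x|lebesgue. (u s x * \<beta> x - u t x * \<beta> x) / (s - t)) - (LINT x|lebesgue. v t x * \<beta> x)"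
      using i by (intro Bochner_Integration.integral_diff) auto
    also have "(LINT x|lebesgue. (u s x * \<beta> x - u t x * \<beta> x) / (s - t)) =
       ((LINT x|lebesgue. u s x * \<beta> x) - (LINT x|lebesgue. u t x * \<beta> x)) / (s - t)"
      using i by simp
    finally show "(LINT x|lebesgue. ((u s x - u t x) / (s - t) - v t x) * \<beta> x) =
      ((LINT x|lebesgue. u s x * \<beta> x) - (LINT x|lebesgue. u t x * \<beta> x)) / (s - t)
        - (LINT x|lebesgue. v t x * \<beta> x)" .
  qed
  ultimately have "((\<lambda>s. ((LINT x|lebesgue. u s x * \<beta> x) - (LINT x|lebesgue. u t x * \<beta> x)) / (s - t)
        - (LINT x|lebesgue. v t x * \<beta> x)) \<longlongrightarrow> 0) (at t within {0..})"
    by (rule Lim_transform_eventually)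
  then show ?thesis
    unfolding has_field_derivative_iff by (rule Lim_null[THEN iffD2])
qed

section \<open>The weak formulation for products of functions of time and space\<close>

lemma has_derivative_tensor:
  fixes \<alpha> :: "real \<Rightarrow> real" and \<beta> :: "'a::euclidean_space \<Rightarrow> real"
  assumes "(\<alpha> has_real_derivative a) (at (fst z))" "(\<beta> has_derivative B) (at (snd z))"
  shows "((\<lambda>z. \<alpha> (fst z) * \<beta> (snd z)) has_derivative
           (\<lambda>h. \<alpha> (fst z) * B (snd h) + a * fst h * \<beta> (snd z))) (at z)"
proof -
  have "((\<lambda>z. \<alpha> (fst z)) has_derivative (\<lambda>h. a * fst h)) (at z)"
    by (rule has_derivative_compose[OF has_derivative_fst[OF has_derivative_ident]])
       (use assms(1) in \<open>simp add: has_field_derivative_def\<close>)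
  moreover have "((\<lambda>z. \<beta> (snd z)) has_derivative (\<lambda>h. B (snd h))) (at z)"
    by (rule has_derivative_compose[OF has_derivative_snd[OF has_derivative_ident]])
       (use assms(2) in simp)
  ultimately show ?thesis by (rule has_derivative_mult)
qed

lemma frechet_derivative_tensor_time:
  fixes \<beta> :: "'a::euclidean_space \<Rightarrow> real"
  assumes "\<And>t. (\<alpha> has_real_derivative \<alpha>' t) (at t)" "elementary_smooth \<beta>"
  shows "(\<lambda>z. frechet_derivative (\<lambda>z. \<alpha> (fst z) * \<beta> (snd z)) (at z) (1, 0))
         = (\<lambda>z. \<alpha>' (fst z) * \<beta> (snd z))"
proof
  fix z :: "real \<times> 'a"
  have "(\<beta> has_derivative frechet_derivative \<beta> (at (snd z))) (at (snd z))"
    using es_frechet_derivative(1)[OF assms(2)] by (simp add: frechet_derivative_works)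
  note d = has_derivative_tensor[OF assms(1) this]
  show "frechet_derivative (\<lambda>z. \<alpha> (fst z) * \<beta> (snd z)) (at z) (1, 0) = \<alpha>' (fst z) * \<beta> (snd z)"
    unfolding frechet_derivative_at[OF d, symmetric]
    using es_frechet_derivative(1)[OF assms(2)]
    by (simp add: linear_0 linear_frechet_derivative)
qed

lemma frechet_derivative_tensor_space:
  fixes \<beta> :: "'a::euclidean_space \<Rightarrow> real"
  assumes "\<And>t. (\<alpha> has_real_derivative \<alpha>' t) (at t)" "elementary_smooth \<beta>"
  shows "(\<lambda>z. frechet_derivative (\<lambda>z. \<alpha> (fst z) * \<beta> (snd z)) (at z) (0, b))
         = (\<lambda>z. \<alpha> (fst z) * frechet_derivative \<beta> (at (snd z)) b)"
proof
  fix z :: "real \<times> 'a"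
  have "(\<beta> has_derivative frechet_derivative \<beta> (at (snd z))) (at (snd z))"
    using es_frechet_derivative(1)[OF assms(2)] by (simp add: frechet_derivative_works)
  note d = has_derivative_tensor[OF assms(1) this]
  show "frechet_derivative (\<lambda>z. \<alpha> (fst z) * \<beta> (snd z)) (at z) (0, b)
      = \<alpha> (fst z) * frechet_derivative \<beta> (at (snd z)) b"
    unfolding frechet_derivative_at[OF d, symmetric] by simp
qed

definition laplacian :: "('a::euclidean_space \<Rightarrow> real) \<Rightarrow> 'a \<Rightarrow> real" where
  "laplacian \<beta> x = (\<Sum>b\<in>Basis. frechet_derivative (\<lambda>y. frechet_derivative \<beta> (at y) b) (at x) b)"

lemma frechet_derivative_zero_outside:
  assumes "\<And>x. x \<notin> C \<Longrightarrow> f x = 0" "closed C" "x \<notin> C"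
  shows "frechet_derivative f (at x) b = (0::real)"
proof -
  have "(f has_derivative (\<lambda>_. 0)) (at x)"
    by (rule has_derivative_transform_within_open[of "\<lambda>_. 0" _ _ _ "- C"])
       (use assms in auto)
  then show ?thesis by (simp add: frechet_derivative_at[symmetric])
qed

text \<open>
  The weight \<open>a\<close> is only known for \<open>t > 0\<close>, and its formula may be singular at \<open>t = -1\<close>.  Since \<open>\<zeta>\<close>
  vanishes for \<open>t < \<epsilon>\<close>, the product rule nevertheless holds on the whole line.
\<close>

lemma DERIV_weighted:
  fixes a a' \<zeta> \<zeta>' :: "real \<Rightarrow> real"
  assumes "\<And>t. t > 0 \<Longrightarrow> (a has_real_derivative a' t) (at t)"
    and "\<And>t. (\<zeta> has_real_derivative \<zeta>' t) (at t)"
    and "\<epsilon> > 0" "\<And>t. t < \<epsilon> \<Longrightarrow> \<zeta> t = 0" "\<And>t. t < \<epsilon> \<Longrightarrow> \<zeta>' t = 0"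
  shows "((\<lambda>t. a t * \<zeta> t) has_real_derivative a' t * \<zeta> t + a t * \<zeta>' t) (at t)"
proof (cases "t < \<epsilon>")
  case True
  have "((\<lambda>t. a t * \<zeta> t) has_real_derivative 0) (at t)"
    by (rule has_field_derivative_transform_within_open[of "\<lambda>_. 0" _ _ "{..<\<epsilon>}"])
       (use True assms(4) in auto)
  then show ?thesis using True assms(4,5) by simp
next
  case False
  with assms(3) have "t > 0" by simp
  from DERIV_mult[OF assms(1)[OF this] assms(2)] show ?thesis by (simp add: add.commute mult.commute)
qed

lemma continuous_weighted:
  fixes a \<zeta> :: "real \<Rightarrow> real"
  assumes "continuous_on {0<..} a" "continuous_on UNIV \<zeta>" "\<epsilon> > 0" "\<And>t. t < \<epsilon> \<Longrightarrow> \<zeta> t = 0"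
  shows "continuous_on UNIV (\<lambda>t. a t * \<zeta> t)"
proof -
  have "continuous_on {0<..} (\<lambda>t. a t * \<zeta> t)"
    by (intro continuous_on_mult assms(1) continuous_on_subset[OF assms(2)]) auto
  moreover have "continuous_on {..<\<epsilon>} (\<lambda>t. a t * \<zeta> t)"
    by (rule continuous_on_eq[of _ "\<lambda>_. 0"]) (use assms(4) in auto)
  ultimately have "continuous_on ({0<..} \<union> {..<\<epsilon>}) (\<lambda>t. a t * \<zeta> t)"
    by (intro continuous_on_open_Un) auto
  moreover have "{0<..} \<union> {..<\<epsilon>} = UNIV" using assms(3) by auto
  ultimately show ?thesis by simp
qed

lemma es_weighted:
  fixes \<zeta> :: "real \<Rightarrow> real"
  assumes "elementary_smooth \<zeta>" "\<epsilon> > 0" "\<And>t. t < \<epsilon> \<Longrightarrow> \<zeta> t = 0"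
  shows "elementary_smooth (\<lambda>t. (1 + t) powr \<mu> * \<zeta> t)"
proof -
  \<comment> \<open>\<open>1 + t\<close> is replaced by a function that is positive on the whole line and agrees with it
      for \<open>t \<ge> \<epsilon>\<close>, where \<open>\<zeta>\<close> may be nonzero\<close>
  have "1 + t * smooth_step (t / \<epsilon>) > 0" for t
    using smooth_step_eq_0[of "t / \<epsilon>"] smooth_step_bounds[of "t / \<epsilon>"] assms(2)
    by (cases "t \<le> 0") (auto simp: divide_le_0_iff add_pos_nonneg)
  moreover have "elementary_smooth (\<lambda>t. 1 + t * smooth_step (1 / \<epsilon> * t))"
    by (intro es_add es_mult es_const es_id es_compose[OF es_smooth_step])
  ultimately have "elementary_smooth (\<lambda>t. (1 + t * smooth_step (t / \<epsilon>)) powr \<mu> * \<zeta> t)"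
    by (intro es_mult es_powr assms(1)) (simp_all)
  moreover have "(1 + t * smooth_step (t / \<epsilon>)) powr \<mu> * \<zeta> t = (1 + t) powr \<mu> * \<zeta> t" for t
    using assms(2) assms(3)[of t] by (cases "t < \<epsilon>") (simp_all add: smooth_step_eq_1)
  ultimately show ?thesis by simp
qed

lemma integrable_tensor:
  fixes W :: "real \<times> 'a::euclidean_space \<Rightarrow> real" and a :: "real \<Rightarrow> real"
  assumes "locally_integrable_on W ({0<..} \<times> UNIV)" "\<epsilon> > 0"
    and "continuous_on UNIV a" "\<And>t. t < \<epsilon> \<or> t > T \<Longrightarrow> a t = 0"
    and "continuous_on UNIV q" "\<And>x. norm x > \<rho> \<Longrightarrow> q x = 0"
  shows "integrable lebesgue (\<lambda>z. W z * (a (fst z) * q (snd z)))"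
proof (rule integrable_locally_integrable_mult[OF assms(1)])
  let ?K = "{\<epsilon>..T} \<times> cball (0::'a) \<rho>"
  show "compact ?K" by (intro compact_Times compact_Icc compact_cball)
  show "?K \<subseteq> {0<..} \<times> UNIV" using assms(2) by auto
  show "continuous_on UNIV (\<lambda>z. a (fst z) * q (snd z))"
    by (intro continuous_on_mult continuous_on_compose2[OF assms(3)] continuous_on_compose2[OF assms(5)]
        continuous_on_fst continuous_on_snd continuous_on_id) auto
  fix z assume "z \<notin> ?K"
  then have "fst z < \<epsilon> \<or> fst z > T \<or> norm (snd z) > \<rho>" by (cases z) auto
  then show "a (fst z) * q (snd z) = 0" using assms(4,6) by auto
qed

lemma tensor_test_function:
  fixes \<alpha> :: "real \<Rightarrow> real" and \<beta> :: "'a::euclidean_space \<Rightarrow> real"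
  assumes "elementary_smooth \<alpha>" "elementary_smooth \<beta>"
    and "\<epsilon> > 0" "\<And>t. t < \<epsilon> \<or> t > T \<Longrightarrow> \<alpha> t = 0" "\<And>x. norm x > \<rho> \<Longrightarrow> \<beta> x = 0"
  shows "(\<lambda>z. \<alpha> (fst z) * \<beta> (snd z)) \<in> test_functions ({0<..} \<times> UNIV)"
proof -
  let ?\<phi> = "\<lambda>z. \<alpha> (fst z) * \<beta> (snd z)"
  let ?K = "{\<epsilon>..T} \<times> cball (0::'a) \<rho>"
  have K: "compact ?K" by (intro compact_Times compact_Icc compact_cball)
  have "{z. ?\<phi> z \<noteq> 0} \<subseteq> ?K"
    using assms(4,5) by (force simp: not_le[symmetric])
  then have c: "closure {z. ?\<phi> z \<noteq> 0} \<subseteq> ?K"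
    by (rule closure_minimal[OF _ compact_imp_closed[OF K]])
  then have "compact (closure {z. ?\<phi> z \<noteq> 0})"
    using compact_Int_closed[OF K, of "closure {z. ?\<phi> z \<noteq> 0}"] by (simp add: Int_absorb1)
  moreover have "?K \<subseteq> {0<..} \<times> UNIV" using assms(3) by auto
  moreover have "C_diff k ?\<phi>" for k
    by (intro es_C_diff es_mult es_fst es_snd assms(1,2))
  ultimately show ?thesis using c unfolding test_functions_def by blast
qed

lemma DERIV_powr_one_plus:
  fixes t :: real
  assumes "t > 0"
  shows "((\<lambda>t. (1 + t) powr m) has_real_derivative m * (1 + t) powr (m - 1)) (at t)"
  using assms by (auto intro!: derivative_eq_intros simp: powr_diff)

text \<open>
  Testing with \<open>g \<zeta> \<beta>\<close> for \<open>g(t) = (1 + t)\<^sup>\<mu>\<close>.  The equation produces the time factor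
  \<open>(g\<zeta>)'' - (\<mu>/(1+t) g\<zeta>)'\<close>.  Because \<open>\<mu>/(1+t) g = g'\<close>, this is \<open>(g\<zeta>')' = g\<zeta>'' + g'\<zeta>'\<close>: no term
  without a derivative of \<open>\<zeta>\<close> remains, which is the reason for the choice of the weight.
\<close>

lemma weak_formulation_tensor:
  fixes w :: "real \<times> 'a::euclidean_space \<Rightarrow> real" and \<zeta> \<zeta>' \<zeta>'' :: "real \<Rightarrow> real"
  assumes sol: "distr_solution \<mu> p w"
    and \<zeta>: "elementary_smooth \<zeta>" "elementary_smooth \<zeta>'" "elementary_smooth \<zeta>''"
      "\<And>t. (\<zeta> has_real_derivative \<zeta>' t) (at t)" "\<And>t. (\<zeta>' has_real_derivative \<zeta>'' t) (at t)"
    and \<epsilon>: "\<epsilon> > 0" "\<And>t. t < \<epsilon> \<or> t > T \<Longrightarrow> \<zeta> t = 0"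
    and \<beta>: "elementary_smooth \<beta>" "\<And>x. norm x > \<rho> \<Longrightarrow> \<beta> x = 0"
  defines "time \<equiv> \<lambda>t. (1 + t) powr \<mu> * \<zeta>'' t + \<mu> * (1 + t) powr (\<mu> - 1) * \<zeta>' t"
  shows "integrable lebesgue (\<lambda>z. \<bar>w z\<bar> powr p * ((1 + fst z) powr \<mu> * \<zeta> (fst z) * \<beta> (snd z)))"
    and "integrable lebesgue (\<lambda>z. w z * (time (fst z) * \<beta> (snd z)))"
    and "integrable lebesgue (\<lambda>z. w z * ((1 + fst z) powr \<mu> * \<zeta> (fst z) * laplacian \<beta> (snd z)))"
    and "(LINT z|lebesgue. \<bar>w z\<bar> powr p * ((1 + fst z) powr \<mu> * \<zeta> (fst z) * \<beta> (snd z)))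
       = (LINT z|lebesgue. w z * (time (fst z) * \<beta> (snd z)))
       - (LINT z|lebesgue. w z * ((1 + fst z) powr \<mu> * \<zeta> (fst z) * laplacian \<beta> (snd z)))"
proof -
  have z1: "\<zeta>' t = 0" if "t < \<epsilon> \<or> t > T" for t
    by (rule deriv_zero_outside[OF \<zeta>(4), of \<epsilon> 0 T 0]) (use \<epsilon> that in auto)
  have z2: "\<zeta>'' t = 0" if "t < \<epsilon> \<or> t > T" for t
    by (rule deriv_zero_outside[OF \<zeta>(5), of \<epsilon> 0 T 0]) (use z1 that in auto)
  define g0 g1 g2 where "g0 t = (1 + t) powr \<mu>" and "g1 t = \<mu> * (1 + t) powr (\<mu> - 1)"
    and "g2 t = \<mu> * ((\<mu> - 1) * (1 + t) powr (\<mu> - 2))" for t :: real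
  have d0: "(g0 has_real_derivative g1 t) (at t)" if "t > 0" for t
    unfolding g0_def[abs_def] g1_def by (rule DERIV_powr_one_plus[OF that])
  have d1: "(g1 has_real_derivative g2 t) (at t)" if "t > 0" for t
    using DERIV_cmult[OF DERIV_powr_one_plus[OF that, of "\<mu> - 1"], of \<mu>]
    unfolding g1_def[abs_def] g2_def by simp
  have c0: "continuous_on {0<..} g0" "continuous_on {0<..} g1" "continuous_on {0<..} g2"
    unfolding g0_def[abs_def] g1_def[abs_def] g2_def[abs_def]
    by (intro continuous_intros; force)+
  \<comment> \<open>\<open>A0 = g\<zeta>\<close> with its first two derivatives, and \<open>B0 = g'\<zeta> = \<mu>/(1+t) g\<zeta>\<close> with its derivative\<close>
  define A0 A1 A2 B0 B1 where "A0 t = g0 t * \<zeta> t" and "A1 t = g1 t * \<zeta> t + g0 t * \<zeta>' t"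
    and "A2 t = (g2 t * \<zeta> t + g1 t * \<zeta>' t) + (g1 t * \<zeta>' t + g0 t * \<zeta>'' t)"
    and "B0 t = g1 t * \<zeta> t" and "B1 t = g2 t * \<zeta> t + g1 t * \<zeta>' t" for t
  have D: "(A0 has_real_derivative A1 t) (at t)" "(A1 has_real_derivative A2 t) (at t)"
    "(B0 has_real_derivative B1 t) (at t)" for t
    unfolding A0_def[abs_def] A1_def[abs_def] A2_def[abs_def] B0_def[abs_def] B1_def[abs_def]
    by (intro DERIV_add DERIV_weighted[OF d0 \<zeta>(4) \<epsilon>(1)] DERIV_weighted[OF d1 \<zeta>(4) \<epsilon>(1)]
        DERIV_weighted[OF d0 \<zeta>(5) \<epsilon>(1)]; use \<epsilon> z1 z2 in blast)+
  have cw: "continuous_on UNIV (\<lambda>t. g t * q t)"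
    if "continuous_on {0<..} g" "elementary_smooth q" "\<And>t. t < \<epsilon> \<or> t > T \<Longrightarrow> q t = 0" for g q
    using continuous_weighted[OF that(1) es_continuous[OF that(2)] \<epsilon>(1)] that(3) by blast
  have cA: "continuous_on UNIV A0" "continuous_on UNIV A2" "continuous_on UNIV B1"
    unfolding A0_def[abs_def] A2_def[abs_def] B1_def[abs_def]
    by (intro continuous_on_add cw c0 \<zeta> \<epsilon> z1 z2; assumption)+
  have zA: "A0 t = 0" "A2 t = 0" "B1 t = 0" if "t < \<epsilon> \<or> t > T" for t
    using z1[OF that] z2[OF that] \<epsilon>(2)[OF that] by (auto simp: A0_def A2_def B1_def)
  have int: "integrable lebesgue (\<lambda>z. W z * (a (fst z) * q (snd z)))"
    if "locally_integrable_on W ({0<..} \<times> UNIV)" "continuous_on UNIV a"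
      "\<And>t. t < \<epsilon> \<or> t > T \<Longrightarrow> a t = 0" "continuous_on UNIV q" "\<And>x. norm x > \<rho> \<Longrightarrow> q x = 0"
    for W :: "real \<times> 'a \<Rightarrow> real" and a :: "real \<Rightarrow> real" and q :: "'a \<Rightarrow> real"
    using integrable_tensor[OF that(1) \<epsilon>(1) that(2-5)] .
  have lw: "locally_integrable_on w ({0<..} \<times> UNIV)"
    "locally_integrable_on (\<lambda>z. \<bar>w z\<bar> powr p) ({0<..} \<times> UNIV)"
    using sol by (auto simp: distr_solution_def)
  define B where "B b x = frechet_derivative (\<lambda>y. frechet_derivative \<beta> (at y) b) (at x) b" for b x
  have esB: "elementary_smooth (B b)" for b
    unfolding B_def[abs_def] by (intro es_frechet_derivative(2) \<beta>(1))
  have B0: "B b x = 0" if "norm x > \<rho>" for b x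
    unfolding B_def
    by (rule frechet_derivative_zero_outside[of "cball 0 \<rho>"])
       (use that \<beta>(2) in \<open>auto intro!: frechet_derivative_zero_outside[of "cball 0 \<rho>"]\<close>)
  have lap: "laplacian \<beta> x = (\<Sum>b\<in>Basis. B b x)" for x by (simp add: laplacian_def B_def)
  note [simp] = es_continuous[OF \<beta>(1)] es_continuous[OF esB]
  have i1: "integrable lebesgue (\<lambda>z. w z * (A2 (fst z) * \<beta> (snd z)))"
    by (rule int[OF lw(1) cA(2) zA(2)]) (use \<beta> in auto)
  have i2: "integrable lebesgue (\<lambda>z. w z * (B1 (fst z) * \<beta> (snd z)))"
    by (rule int[OF lw(1) cA(3) zA(3)]) (use \<beta> in auto)
  have i3: "integrable lebesgue (\<lambda>z. w z * (A0 (fst z) * B b (snd z)))" for b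
    by (rule int[OF lw(1) cA(1) zA(1)]) (use B0 in auto)
  have i4: "integrable lebesgue (\<lambda>z. \<bar>w z\<bar> powr p * (A0 (fst z) * \<beta> (snd z)))"
    by (rule int[OF lw(2) cA(1) zA(1)]) (use \<beta> in auto)
  have e1: "w z * (time (fst z) * \<beta> (snd z))
      = w z * (A2 (fst z) * \<beta> (snd z)) - w z * (B1 (fst z) * \<beta> (snd z))" for z
    by (simp add: time_def A2_def B1_def g0_def g1_def algebra_simps)
  have e2: "w z * ((1 + fst z) powr \<mu> * \<zeta> (fst z) * laplacian \<beta> (snd z))
      = (\<Sum>b\<in>Basis. w z * (A0 (fst z) * B b (snd z)))" for z
    by (simp add: lap A0_def g0_def sum_distrib_left)
  show "integrable lebesgue (\<lambda>z. \<bar>w z\<bar> powr p * ((1 + fst z) powr \<mu> * \<zeta> (fst z) * \<beta> (snd z)))"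
    using i4 by (simp add: A0_def g0_def)
  show "integrable lebesgue (\<lambda>z. w z * (time (fst z) * \<beta> (snd z)))"
    unfolding e1 using i1 i2 by (rule Bochner_Integration.integrable_diff)
  show "integrable lebesgue (\<lambda>z. w z * ((1 + fst z) powr \<mu> * \<zeta> (fst z) * laplacian \<beta> (snd z)))"
    unfolding e2 using i3 by (intro Bochner_Integration.integrable_sum)
  define \<phi> where "\<phi> z = A0 (fst z) * \<beta> (snd z)" for z :: "real \<times> 'a"
  have esA0: "elementary_smooth A0"
    unfolding A0_def[abs_def] g0_def by (rule es_weighted[OF \<zeta>(1) \<epsilon>(1)]) (use \<epsilon> in auto)
  have test: "\<phi> \<in> test_functions ({0<..} \<times> UNIV)"
    unfolding \<phi>_def[abs_def]
    by (rule tensor_test_function[OF esA0 \<beta>(1) \<epsilon>(1) zA(1)]) (use \<beta> in auto)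
  have t1: "(\<lambda>z. frechet_derivative \<phi> (at z) (1, 0)) = (\<lambda>z. A1 (fst z) * \<beta> (snd z))"
    unfolding \<phi>_def[abs_def] by (rule frechet_derivative_tensor_time[OF D(1) \<beta>(1)])
  have t2: "(\<lambda>z. frechet_derivative (\<lambda>z. A1 (fst z) * \<beta> (snd z)) (at z) (1, 0))
      = (\<lambda>z. A2 (fst z) * \<beta> (snd z))"
    by (rule frechet_derivative_tensor_time[OF D(2) \<beta>(1)])
  have t3: "(\<lambda>z. (case z of (t, x) \<Rightarrow> \<mu> / (1 + t)) * \<phi> z) = (\<lambda>z. B0 (fst z) * \<beta> (snd z))"
  proof
    fix z :: "real \<times> 'a"
    have "\<mu> / (1 + t) * A0 t = B0 t" for t
      using \<epsilon>(2)[of t] \<epsilon>(1) by (cases "t < \<epsilon>") (auto simp: A0_def B0_def g0_def g1_def powr_diff)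
    then show "(case z of (t, x) \<Rightarrow> \<mu> / (1 + t)) * \<phi> z = B0 (fst z) * \<beta> (snd z)"
      by (cases z) (simp add: \<phi>_def mult.assoc[symmetric])
  qed
  have t4: "(\<lambda>z. frechet_derivative (\<lambda>z. B0 (fst z) * \<beta> (snd z)) (at z) (1, 0))
      = (\<lambda>z. B1 (fst z) * \<beta> (snd z))"
    by (rule frechet_derivative_tensor_time[OF D(3) \<beta>(1)])
  have t5: "(\<lambda>z. frechet_derivative \<phi> (at z) (0, b)) = (\<lambda>z. A0 (fst z) * frechet_derivative \<beta> (at (snd z)) b)" for b
    unfolding \<phi>_def[abs_def] by (rule frechet_derivative_tensor_space[OF D(1) \<beta>(1)])
  have t6: "(\<lambda>z. frechet_derivative (\<lambda>z. A0 (fst z) * frechet_derivative \<beta> (at (snd z)) b) (at z) (0, b))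
      = (\<lambda>z. A0 (fst z) * B b (snd z))" for b
    unfolding B_def by (rule frechet_derivative_tensor_space[OF D(1) es_frechet_derivative(2)[OF \<beta>(1)]])
  have "distr_deriv (1, 0) (distr_deriv (1, 0) (distr_of_fun w)) \<phi>
        - (\<Sum>b\<in>Basis. distr_deriv (0, b) (distr_deriv (0, b) (distr_of_fun w)) \<phi>)
        + distr_mult (\<lambda>(t, x). \<mu> / (1 + t)) (distr_deriv (1, 0) (distr_of_fun w)) \<phi>
        = distr_of_fun (\<lambda>z. \<bar>w z\<bar> powr p) \<phi>"
    using sol test unfolding distr_solution_def by blast
  then have eq: "(LINT z|lebesgue. w z * (A2 (fst z) * \<beta> (snd z)))
      - (\<Sum>b\<in>Basis. (LINT z|lebesgue. w z * (A0 (fst z) * B b (snd z))))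
      - (LINT z|lebesgue. w z * (B1 (fst z) * \<beta> (snd z)))
      = (LINT z|lebesgue. \<bar>w z\<bar> powr p * \<phi> z)"
    unfolding distr_deriv_def distr_mult_def t1 t2 t3 t4 t5 t6 by (simp add: distr_of_fun_def)
  show "(LINT z|lebesgue. \<bar>w z\<bar> powr p * ((1 + fst z) powr \<mu> * \<zeta> (fst z) * \<beta> (snd z)))
       = (LINT z|lebesgue. w z * (time (fst z) * \<beta> (snd z)))
       - (LINT z|lebesgue. w z * ((1 + fst z) powr \<mu> * \<zeta> (fst z) * laplacian \<beta> (snd z)))"
    unfolding e1 e2 Bochner_Integration.integral_diff[OF i1 i2] Bochner_Integration.integral_sum[OF i3]
    using eq by (simp add: \<phi>_def A0_def g0_def)
qed

section \<open>Recovering the initial velocity\<close>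

definition onset :: "real \<Rightarrow> real \<Rightarrow> real" where
  "onset \<epsilon> t = smooth_step (t / \<epsilon> - 1)"

lemma onset_props:
  assumes "\<epsilon> > 0"
  shows onset_eq_0: "t \<le> \<epsilon> \<Longrightarrow> onset \<epsilon> t = 0" and onset_eq_1: "t \<ge> 2 * \<epsilon> \<Longrightarrow> onset \<epsilon> t = 1"
    and onset_bounds: "0 \<le> onset \<epsilon> t" "onset \<epsilon> t \<le> 1"
    and es_onset: "elementary_smooth (onset \<epsilon>)"
proof -
  show "t \<le> \<epsilon> \<Longrightarrow> onset \<epsilon> t = 0" "t \<ge> 2 * \<epsilon> \<Longrightarrow> onset \<epsilon> t = 1"
    using assms by (auto simp: onset_def field_simps intro!: smooth_step_eq_0 smooth_step_eq_1)
  show "0 \<le> onset \<epsilon> t" "onset \<epsilon> t \<le> 1" by (auto simp: onset_def smooth_step_bounds)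
  have "elementary_smooth (\<lambda>t. smooth_step (1 / \<epsilon> * t - 1))"
    by (intro es_compose[OF es_smooth_step] es_diff es_mult es_const es_id)
  then show "elementary_smooth (onset \<epsilon>)" by (simp add: onset_def[abs_def])
qed

lemma onset_deriv_nonneg:
  assumes "\<epsilon> > 0" "(onset \<epsilon> has_real_derivative d) (at t)"
  shows "d \<ge> 0"
proof (rule mono_on_imp_deriv_nonneg[OF _ assms(2), of UNIV])
  show "mono (onset \<epsilon>)"
    using assms(1) by (auto intro!: monoI smooth_step_mono divide_right_mono simp: onset_def)
qed simp

lemma onset_derivs_eq_0:
  assumes "\<epsilon> > 0" "t < \<epsilon> \<or> t > 2 * \<epsilon>"
    and "\<And>t. (onset \<epsilon> has_real_derivative \<theta>' t) (at t)"
    and "\<And>t. (\<theta>' has_real_derivative \<theta>'' t) (at t)"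
  shows "\<theta>' t = 0" "\<theta>'' t = 0"
proof -
  have z1: "\<theta>' t = 0" if "t < \<epsilon> \<or> t > 2 * \<epsilon>" for t
    by (rule deriv_zero_outside[OF assms(3), of \<epsilon> 0 "2 * \<epsilon>" 1])
       (use that onset_eq_0[OF assms(1)] onset_eq_1[OF assms(1)] in auto)
  show "\<theta>' t = 0" by (rule z1[OF assms(2)])
  show "\<theta>'' t = 0"
    by (rule deriv_zero_outside[OF assms(4), of \<epsilon> 0 "2 * \<epsilon>" 0]) (use z1 assms(2) in auto)
qed

text \<open>
  The function \<open>U(t) = \<integral>u(t,x) \<beta>(x) dx\<close> is continuously differentiable with derivative
  \<open>V(t) = \<integral>v(t,x) \<beta>(x) dx\<close>, and the time factor is \<open>G'\<close> for \<open>G = g \<theta>'\<close>, where \<open>\<theta>'\<close> is the derivative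
  of the onset function.  Integration by parts in \<open>t\<close> gives \<open>\<integral>U G' = - \<integral>V g \<theta>'\<close>.
  Here \<open>\<theta>' \<ge> 0\<close> has integral \<open>1\<close>, so \<open>V \<ge> c\<close> near \<open>t = 0\<close> and \<open>g \<ge> 1\<close> yield the bound.
\<close>

lemma initial_layer:
  fixes w :: "real \<times> 'a::euclidean_space \<Rightarrow> real" and \<theta>' \<theta>'' :: "real \<Rightarrow> real"
  assumes u: "has_curve_deriv L2 L2_norm u v" and v: "continuous_curve L2 L2_norm v"
    and \<beta>: "\<beta> \<in> L2"
    and wu: "\<And>t. t > 0 \<Longrightarrow> AE x in lebesgue. w (t, x) = u t x"
    and \<mu>: "\<mu> \<ge> 0" and c: "c \<ge> 0"
    and V: "\<And>t. 0 \<le> t \<Longrightarrow> t \<le> 3 * \<epsilon> \<Longrightarrow> c \<le> (LINT x|lebesgue. v t x * \<beta> x)"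
    and \<epsilon>: "\<epsilon> > 0"
    and \<theta>': "elementary_smooth \<theta>'" "\<And>t. (onset \<epsilon> has_real_derivative \<theta>' t) (at t)"
    and \<theta>'': "elementary_smooth \<theta>''" "\<And>t. (\<theta>' has_real_derivative \<theta>'' t) (at t)"
  defines "time \<equiv> \<lambda>t. (1 + t) powr \<mu> * \<theta>'' t + \<mu> * (1 + t) powr (\<mu> - 1) * \<theta>' t"
  assumes int: "integrable lebesgue (\<lambda>z. w z * (time (fst z) * \<beta> (snd z)))"
  shows "(LINT z|lebesgue. w z * (time (fst z) * \<beta> (snd z))) \<le> - c"
proof -
  define U where "U t = (LINT x|lebesgue. u t x * \<beta> x)" for t
  define V where "V t = (LINT x|lebesgue. v t x * \<beta> x)" for t
  \<comment> \<open>an interval that exceeds \<open>{\<epsilon>..2 * \<epsilon>}\<close> on both sides, so that \<open>G\<close> vanishes at its end points\<close>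
  define a b where "a = \<epsilon> / 2" and "b = 3 * \<epsilon>"
  have ab: "0 < a" "a < \<epsilon>" "2 * \<epsilon> < b" "a \<le> b" using \<epsilon> by (auto simp: a_def b_def)
  note z1 = onset_derivs_eq_0(1)[OF \<epsilon> _ \<theta>'(2) \<theta>''(2)]
    and z2 = onset_derivs_eq_0(2)[OF \<epsilon> _ \<theta>'(2) \<theta>''(2)]
  have dU: "(U has_real_derivative V t) (at t)" if "t > 0" for t
  proof -
    have "(U has_real_derivative V t) (at t within {0..})"
      unfolding U_def[abs_def] V_def using curve_pairing_deriv[OF u \<beta>, of t] that by simp
    moreover have "at t within {0..} = at t"
      using that by (intro at_within_interior) (simp add: interior_real_atLeast)
    ultimately show ?thesis by simp
  qed
  have cV: "continuous_on {a..b} V"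
    unfolding V_def[abs_def]
    by (rule continuous_on_subset[OF curve_pairing_continuous[OF v \<beta>]]) (use ab in auto)
  have cU: "continuous_on {a..b} U"
    by (intro continuous_at_imp_continuous_on ballI DERIV_isCont[OF dU]) (use ab in auto)
  define G where "G t = (1 + t) powr \<mu> * \<theta>' t" for t
  have dG: "(G has_real_derivative time t) (at t)" if "t > 0" for t
    unfolding G_def[abs_def] time_def
    using DERIV_mult[OF DERIV_powr_one_plus[OF that] \<theta>''(2)] by (simp add: ac_simps)
  have cG: "continuous_on {a..b} G"
    by (intro continuous_at_imp_continuous_on ballI DERIV_isCont[OF dG]) (use ab in auto)
  have ct: "continuous_on {a..b} time"
    unfolding time_def using ab
    by (intro continuous_intros es_continuous \<theta>' \<theta>'') auto
  have iU: "(\<lambda>t. U t * time t) integrable_on {a..b}" and iV: "(\<lambda>t. V t * G t) integrable_on {a..b}"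
    by (intro integrable_continuous_real continuous_on_mult cU cV ct cG)+
  have "((\<lambda>t. U t * time t + V t * G t) has_integral (U b * G b - U a * G a)) {a..b}"
  proof (rule fundamental_theorem_of_calculus)
    fix t assume t: "t \<in> {a..b}"
    then have "t > 0" using ab by auto
    from DERIV_mult[OF dU[OF this] dG[OF this]]
    have "((\<lambda>t. U t * G t) has_real_derivative (U t * time t + V t * G t)) (at t)"
      by (simp add: ac_simps)
    then show "((\<lambda>t. U t * G t) has_vector_derivative (U t * time t + V t * G t)) (at t within {a..b})"
      using has_field_derivative_at_within has_real_derivative_iff_has_vector_derivative by blast
  qed (use ab in simp)
  moreover have "G a = 0" "G b = 0" using z1 ab by (auto simp: G_def)
  ultimately have "integral {a..b} (\<lambda>t. U t * time t + V t * G t) = 0"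
    by (simp add: integral_unique)
  then have parts: "integral {a..b} (\<lambda>t. U t * time t) = - integral {a..b} (\<lambda>t. V t * G t)"
    using Henstock_Kurzweil_Integration.integral_add[OF iU iV] by simp
  have h1: "((\<lambda>t. c * \<theta>' t) has_integral (c * onset \<epsilon> b - c * onset \<epsilon> a)) {a..b}"
  proof (rule fundamental_theorem_of_calculus)
    fix t assume t: "t \<in> {a..b}"
    have "((\<lambda>t. c * onset \<epsilon> t) has_real_derivative (c * \<theta>' t)) (at t within {a..b})"
      by (rule has_field_derivative_at_within[OF DERIV_cmult[OF \<theta>'(2)]])
    then show "((\<lambda>t. c * onset \<epsilon> t) has_vector_derivative (c * \<theta>' t)) (at t within {a..b})"
      by (simp add: has_real_derivative_iff_has_vector_derivative)
  qed (use ab in simp)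
  have "c * onset \<epsilon> b - c * onset \<epsilon> a = c" using onset_eq_0[OF \<epsilon>] onset_eq_1[OF \<epsilon>] ab by simp
  with h1 have h1: "((\<lambda>t. c * \<theta>' t) has_integral c) {a..b}" by simp
  have "c \<le> integral {a..b} (\<lambda>t. V t * G t)"
  proof (rule has_integral_le[OF h1 integrable_integral[OF iV]])
    fix t assume t: "t \<in> {a..b}"
    have "c \<le> V t" using V[of t] t ab by (simp add: V_def b_def)
    moreover have "\<theta>' t \<ge> 0" by (rule onset_deriv_nonneg[OF \<epsilon> \<theta>'(2)])
    moreover have "1 \<le> (1 + t) powr \<mu>" using t ab \<mu> by (intro ge_one_powr_ge_zero) auto
    ultimately have "c * (1 * \<theta>' t) \<le> V t * ((1 + t) powr \<mu> * \<theta>' t)"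
      using c by (intro mult_mono) auto
    then show "c * \<theta>' t \<le> V t * G t" by (simp add: G_def)
  qed
  with parts have le: "integral {a..b} (\<lambda>t. U t * time t) \<le> - c" by simp
  have si: "set_integrable lborel {a..b} (\<lambda>t. U t * time t)"
    by (intro borel_integrable_atLeastAtMost' continuous_on_mult cU ct)
  \<comment> \<open>the curve \<open>u\<close> carries no information for \<open>t < 0\<close>, hence the case distinction\<close>
  define k where "k t x = (if t > 0 then time t * (u t x * \<beta> x) else 0)" for t x
  have zt: "time t = 0" if "t < \<epsilon> \<or> t > 2 * \<epsilon>" for t using z1[OF that] z2[OF that] by (simp add: time_def)
  have Ik: "(LINT x|lebesgue. k t x) = indicator {a..b} t *\<^sub>R (U t * time t)" for t
    using ab zt[of t] by (cases "t > 0") (auto simp: k_def U_def split: split_indicator)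
  have "(LINT z|lebesgue. w z * (time (fst z) * \<beta> (snd z))) = (LINT t|lborel. LINT x|lebesgue. k t x)"
  proof (rule integral_lebesgue_iterated[OF int])
    fix t
    have L2u: "u t \<in> L2" if "t > 0" using u that by (auto simp: has_curve_deriv_def)
    show "AE x in lebesgue. w (t, x) * (time (fst (t, x)) * \<beta> (snd (t, x))) = k t x"
    proof (cases "t > 0")
      case True
      from wu[OF this] show ?thesis by eventually_elim (use True in \<open>simp add: k_def\<close>)
    next
      case False
      then show ?thesis using zt[of t] \<epsilon> by (simp add: k_def)
    qed
    show "k t \<in> borel_measurable lebesgue"
      unfolding k_def[abs_def] using L2u \<beta> by (cases "t > 0") (auto simp: L2_def)
  next
    show "(\<lambda>t. LINT x|lebesgue. k t x) \<in> borel_measurable borel"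
      unfolding Ik using si by (auto simp: set_integrable_def dest: borel_measurable_integrable)
  qed
  also have "\<dots> = integral {a..b} (\<lambda>t. U t * time t)"
    unfolding Ik using set_borel_integral_eq_integral(2)[OF si] by (simp add: set_lebesgue_integral_def)
  finally show ?thesis using le by simp
qed

lemma laplacian_radial:
  fixes S S' S'' :: "real \<Rightarrow> real" and x :: "'a::euclidean_space"
  assumes S: "\<And>s. (S has_real_derivative S' s) (at s)" "\<And>s. (S' has_real_derivative S'' s) (at s)"
    and c: "c \<noteq> 0"
  shows "laplacian (\<lambda>x. S ((x \<bullet> x) / c)) x
     = 4 * S'' ((x \<bullet> x) / c) * (x \<bullet> x) / c\<^sup>2 + 2 * real DIM('a) * S' ((x \<bullet> x) / c) / c"
proof -
  have d0: "((\<lambda>x::'a. (x \<bullet> x) / c) has_derivative (\<lambda>h. 2 * (x \<bullet> h) / c)) (at x)" for x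
    using c by (auto intro!: derivative_eq_intros simp: inner_commute)
  have d1: "((\<lambda>x::'a. S ((x \<bullet> x) / c)) has_derivative (\<lambda>h. S' ((x \<bullet> x) / c) * (2 * (x \<bullet> h) / c))) (at x)" for x
    using has_derivative_compose[OF d0 S(1)[unfolded has_field_derivative_def]] .
  have d2: "((\<lambda>x::'a. S' ((x \<bullet> x) / c)) has_derivative (\<lambda>h. S'' ((x \<bullet> x) / c) * (2 * (x \<bullet> h) / c))) (at x)" for x
    using has_derivative_compose[OF d0 S(2)[unfolded has_field_derivative_def]] .
  have d3: "((\<lambda>x::'a. 2 * (x \<bullet> b) / c) has_derivative (\<lambda>h. 2 * (h \<bullet> b) / c)) (at x)" for x b
    using c by (auto intro!: derivative_eq_intros)
  have f1: "frechet_derivative (\<lambda>x::'a. S ((x \<bullet> x) / c)) (at y) b = S' ((y \<bullet> y) / c) * (2 * (y \<bullet> b) / c)" for y b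
    using c by (simp add: frechet_derivative_at[OF d1, symmetric])
  have f2: "frechet_derivative (\<lambda>y::'a. S' ((y \<bullet> y) / c) * (2 * (y \<bullet> b) / c)) (at x) b
     = S' ((x \<bullet> x) / c) * (2 * (b \<bullet> b) / c) + S'' ((x \<bullet> x) / c) * (2 * (x \<bullet> b) / c) * (2 * (x \<bullet> b) / c)" for b
    unfolding frechet_derivative_at[OF has_derivative_mult[OF d2 d3], symmetric] by (rule refl)
  have "laplacian (\<lambda>x. S ((x \<bullet> x) / c)) x
     = (\<Sum>b\<in>Basis. 2 * S' ((x \<bullet> x) / c) / c + 4 * S'' ((x \<bullet> x) / c) / c\<^sup>2 * ((x \<bullet> b) * (x \<bullet> b)))"
    unfolding laplacian_def f1 f2
    by (rule sum.cong) (auto simp: power2_eq_square field_simps)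
  also have "\<dots> = real DIM('a) * (2 * S' ((x \<bullet> x) / c) / c)
      + 4 * S'' ((x \<bullet> x) / c) / c\<^sup>2 * (\<Sum>b\<in>Basis. (x \<bullet> b) * (x \<bullet> b))"
    by (simp add: sum.distrib sum_distrib_left)
  also have "(\<Sum>b\<in>Basis. (x \<bullet> b) * (x \<bullet> b)) = x \<bullet> x" by (rule euclidean_inner[symmetric])
  finally show ?thesis using c by (simp add: field_simps)
qed

section \<open>The test function inequality\<close>

lemma Youngs_inequality_weighted:
  fixes a b p k :: real
  assumes "p > 1" "a \<ge> 0" "b \<ge> 0" "k > 0"
  shows "a * b \<le> k * a powr p + k powr (- 1 / (p - 1)) * b powr (p / (p - 1))"
proof -
  define q where "q = p / (p - 1)"
  have q: "q > 1" "1 / p + 1 / q = 1" "- 1 / p * q = - 1 / (p - 1)"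
    using assms(1) by (auto simp: q_def field_simps)
  have "a * b = (k powr (1 / p) * a) * (k powr (- 1 / p) * b)"
    using assms(4) by (simp add: powr_minus field_simps)
  also have "\<dots> \<le> (k powr (1 / p) * a) powr p / p + (k powr (- 1 / p) * b) powr q / q"
    by (rule Youngs_inequality) (use assms q in auto)
  also have "(k powr (1 / p) * a) powr p = k * a powr p"
    using assms by (simp add: powr_mult powr_powr)
  also have "(k powr (- 1 / p) * b) powr q = k powr (- 1 / (p - 1)) * b powr q"
    by (simp only: powr_mult powr_powr q(3))
  also have "k * a powr p / p + k powr (- 1 / (p - 1)) * b powr q / q
      \<le> k * a powr p + k powr (- 1 / (p - 1)) * b powr q"
  proof -
    have "X / s \<le> X" if "X \<ge> 0" "s > 1" for X s :: real
      using that by (simp add: divide_le_eq mult_le_cancel_left1)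
    then show ?thesis using assms q(1) by (intro add_mono) auto
  qed
  finally show ?thesis by (simp add: q_def)
qed

text \<open>
  The cylinder of size \<open>2R\<close> without the open cylinder of size \<open>R\<close>.  At times \<open>t \<ge> 0\<close> all derivatives
  of the product of the temporal and the spatial cutoff of scale \<open>R\<close> are supported here.
\<close>

definition shell :: "real \<Rightarrow> (real \<times> 'a::euclidean_space) set" where
  "shell R = {z. 0 \<le> fst z \<and> fst z \<le> 2 * R \<and> norm (snd z) \<le> 2 * R \<and> (R \<le> fst z \<or> R \<le> norm (snd z))}"

lemma shell_measurable: "(shell R :: (real \<times> 'a::euclidean_space) set) \<in> sets lebesgue"
proof -
  have "closed (shell R :: (real \<times> 'a) set)"
    unfolding shell_def
    by (intro closed_Collect_conj closed_Collect_disj closed_Collect_le continuous_intros)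
  then show ?thesis by (simp add: borel_closed sets_completionI_sets)
qed

lemma shell_subset_cball: "shell R \<subseteq> cball (0 :: real \<times> 'a::euclidean_space) (4 * R)"
proof
  fix z :: "real \<times> 'a" assume "z \<in> shell R"
  then have "norm (fst z) + norm (snd z) \<le> 4 * R" by (auto simp: shell_def)
  then show "z \<in> cball 0 (4 * R)" using norm_Pair_le[of "fst z" "snd z"] by simp
qed

lemma le_powr_of_le_1:
  fixes y r :: real
  assumes "0 \<le> y" "y \<le> 1" "r \<le> 1"
  shows "y \<le> y powr r"
  using assms powr_mono'[of r 1 y] by (cases "y = 0") auto

text \<open>
  Here \<open>R powr (\<mu> + (n + 1))\<close> is the size of the weight \<open>(1 + t)\<^sup>\<mu>\<close> integrated over the cylinder, and
  \<open>1 / R\<^sup>2\<close> is the size of second derivatives of the cutoff, raised to the conjugate exponent of \<open>p\<close>.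
  The upper bound on \<open>p\<close> is the condition that their product stays bounded.
\<close>

lemma critical_scaling:
  fixes n \<mu> p R :: real
  assumes "n \<ge> 1" "\<mu> > 0" "p > 1" "p \<le> 1 + 2 / (n + (\<mu> - 1))" "R \<ge> 1"
  shows "R powr (\<mu> + (n + 1)) * (1 / R\<^sup>2) powr (p / (p - 1)) \<le> 1"
proof -
  have "(p - 1) * (n + (\<mu> - 1)) \<le> 2"
    using assms by (simp add: pos_le_divide_eq[symmetric])
  then have "(\<mu> + (n + 1)) * (p - 1) \<le> 2 * p" by (simp add: algebra_simps)
  then have "\<mu> + (n + 1) \<le> 2 * (p / (p - 1))" using assms(3) by (simp add: pos_le_divide_eq)
  then have "R powr (\<mu> + (n + 1)) \<le> R powr (2 * (p / (p - 1)))"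
    using assms(5) by (intro powr_mono) auto
  also have "\<dots> = (R\<^sup>2) powr (p / (p - 1))"
    using assms(5) powr_powr[of R 2 "p / (p - 1)"] by simp
  finally show ?thesis
    using assms(5) by (simp add: powr_divide divide_le_eq)
qed

context cutoff
begin

definition ball_cutoff :: "real \<Rightarrow> 'a::euclidean_space \<Rightarrow> real" where
  "ball_cutoff R x = S ((x \<bullet> x) / R\<^sup>2)"

definition cyl_cutoff :: "real \<Rightarrow> real \<Rightarrow> real \<times> 'a::euclidean_space \<Rightarrow> real" where
  "cyl_cutoff \<epsilon> R z = onset \<epsilon> (fst z) * S (fst z / R) * ball_cutoff R (snd z)"

text \<open>
  What the equation leaves of the test function \<open>g \<Psi>\<close>, \<open>\<Psi>\<close> being the cylindrical cutoff, when the
  derivative falls on the cutoff at time scale \<open>R\<close> or on the spatial cutoff.  The contribution of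
  \<open>onset\<close> is treated separately by \<open>initial_layer\<close>.
\<close>

definition residual :: "real \<Rightarrow> real \<Rightarrow> real \<Rightarrow> real \<times> 'a::euclidean_space \<Rightarrow> real" where
  "residual \<mu> \<epsilon> R z =
     ((1 + fst z) powr \<mu> * (S'' (fst z / R) / R\<^sup>2)
        + \<mu> * (1 + fst z) powr (\<mu> - 1) * (S' (fst z / R) / R)) * ball_cutoff R (snd z)
     - (1 + fst z) powr \<mu> * (onset \<epsilon> (fst z) * S (fst z / R)) * laplacian (ball_cutoff R) (snd z)"

lemma es_ball_cutoff: "elementary_smooth (ball_cutoff R)"
proof -
  have "elementary_smooth (\<lambda>x::'a. \<Sum>b\<in>Basis. (x \<bullet> b) * (x \<bullet> b))"
    by (intro es_sum es_mult es_inner)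
  then have "elementary_smooth (\<lambda>x::'a. x \<bullet> x)"
    by (simp add: euclidean_inner[symmetric])
  then have "elementary_smooth (\<lambda>x::'a. S (1 / R\<^sup>2 * (x \<bullet> x)))"
    by (intro es_compose[OF es_S(1)] es_cmult)
  then show ?thesis by (simp add: ball_cutoff_def[abs_def])
qed

lemma ball_cutoff_bounds: "0 \<le> ball_cutoff R x" "ball_cutoff R x \<le> 1"
  by (auto simp: ball_cutoff_def S_bounds)

lemma ball_cutoff_eq_1: "R > 0 \<Longrightarrow> norm x \<le> R \<Longrightarrow> ball_cutoff R x = 1"
  by (auto simp: ball_cutoff_def power2_norm_eq_inner[symmetric] intro!: S_eq power_mono)

lemma ball_cutoff_eq_0:
  assumes "R > 0" "norm x > 2 * R"
  shows "ball_cutoff R x = 0"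
proof -
  have "(2 * R)\<^sup>2 \<le> (norm x)\<^sup>2" using assms by (intro power_mono) auto
  moreover have "2 * R\<^sup>2 \<le> (2 * R)\<^sup>2" by (simp add: power_mult_distrib)
  ultimately have "2 * R\<^sup>2 \<le> (norm x)\<^sup>2" by linarith
  then show ?thesis
    using assms(1) by (auto simp: ball_cutoff_def power2_norm_eq_inner[symmetric] pos_le_divide_eq intro!: S_eq)
qed

lemma ball_cutoff_L2:
  assumes R0: "R > 0"
  shows "(ball_cutoff R :: 'a::euclidean_space \<Rightarrow> real) \<in> L2"
proof -
  have "integrable lebesgue (\<lambda>x::'a. (ball_cutoff R x)\<^sup>2)"
    by (rule integrable_continuous_supported[of _ "cball 0 (2 * R)"])
       (auto intro!: es_continuous es_power es_ball_cutoff simp: ball_cutoff_eq_0[OF R0])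
  moreover have "integrable lebesgue (ball_cutoff R :: 'a \<Rightarrow> real)"
    by (rule integrable_continuous_supported[of _ "cball 0 (2 * R)"])
       (auto intro!: es_continuous es_ball_cutoff simp: ball_cutoff_eq_0[OF R0])
  ultimately show ?thesis by (auto simp: L2_def dest: borel_measurable_integrable)
qed

lemma cyl_cutoff_bounds: "\<epsilon> > 0 \<Longrightarrow> 0 \<le> cyl_cutoff \<epsilon> R z"
  by (auto simp: cyl_cutoff_def intro!: mult_nonneg_nonneg onset_bounds S_bounds ball_cutoff_bounds)

text \<open>
  By scaling the Laplacian is of order \<open>R\<^sup>-\<^sup>2\<close>.  The factor \<open>|x|\<^sup>2/R\<^sup>2\<close> that accompanies \<open>S''\<close> is at most
  \<open>2\<close> wherever \<open>S''\<close> does not vanish.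
\<close>

lemma laplacian_ball_cutoff_bound:
  fixes x :: "'a::euclidean_space"
  assumes R: "R > 0"
  shows "\<bar>laplacian (ball_cutoff R) x\<bar> \<le> (8 + 2 * real DIM('a)) * M * ball_cutoff R x powr r / R\<^sup>2"
    and "laplacian (ball_cutoff R) x \<noteq> 0 \<Longrightarrow> R \<le> norm x \<and> norm x \<le> 2 * R"
proof -
  define s where "s = (x \<bullet> x) / R\<^sup>2"
  have s0: "s \<ge> 0" by (simp add: s_def)
  have "laplacian (ball_cutoff R) x = 4 * S'' s * (x \<bullet> x) / (R\<^sup>2)\<^sup>2 + 2 * real DIM('a) * S' s / R\<^sup>2"
    unfolding ball_cutoff_def[abs_def] s_def using R by (intro laplacian_radial deriv_S) simp
  also have "(x \<bullet> x) = s * R\<^sup>2" using R by (simp add: s_def)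
  finally have L: "laplacian (ball_cutoff R) x = (4 * S'' s * s + 2 * real DIM('a) * S' s) / R\<^sup>2"
    using R by (simp add: field_simps power2_eq_square)
  have "\<bar>S'' s * s\<bar> \<le> 2 * (M * S s powr r)"
  proof (cases "s > 2")
    case True
    then show ?thesis using S'_eq_0(2)[of s] M(1) by simp
  next
    case False
    then have "\<bar>S'' s\<bar> * s \<le> (M * S s powr r) * 2"
      using s0 M by (intro mult_mono) auto
    then show ?thesis using s0 by (simp add: abs_mult)
  qed
  moreover have "\<bar>2 * real DIM('a) * S' s\<bar> \<le> 2 * real DIM('a) * (M * S s powr r)"
    unfolding abs_mult using M(2)[of s] by (intro mult_mono) auto
  ultimately have "\<bar>4 * S'' s * s + 2 * real DIM('a) * S' s\<bar> \<le> 8 * (M * S s powr r) + 2 * real DIM('a) * (M * S s powr r)"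
    by linarith
  then show "\<bar>laplacian (ball_cutoff R) x\<bar> \<le> (8 + 2 * real DIM('a)) * M * ball_cutoff R x powr r / R\<^sup>2"
    unfolding L by (simp add: abs_divide divide_right_mono ball_cutoff_def s_def[symmetric] algebra_simps)
  show "R \<le> norm x \<and> norm x \<le> 2 * R" if "laplacian (ball_cutoff R) x \<noteq> 0"
  proof -
    have "\<not> (s < 1 \<or> 2 < s)" using that S'_eq_0[of s] L by auto
    then have "R\<^sup>2 \<le> (norm x)\<^sup>2" "(norm x)\<^sup>2 \<le> 2 * R\<^sup>2"
      using R by (auto simp: s_def power2_norm_eq_inner not_less pos_le_divide_eq pos_divide_le_eq)
    moreover have "2 * R\<^sup>2 \<le> (2 * R)\<^sup>2" by (simp add: power_mult_distrib)
    ultimately have "R\<^sup>2 \<le> (norm x)\<^sup>2" "(norm x)\<^sup>2 \<le> (2 * R)\<^sup>2" by linarith+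
    then show ?thesis using R power2_le_imp_le[of R "norm x"] power2_le_imp_le[of "norm x" "2 * R"] by simp
  qed
qed

text \<open>
  Each term carries two derivatives of a cutoff at scale \<open>R\<close>, or one such derivative and one of the
  weight; the latter satisfies \<open>g' \<le> g/(1+t) \<le> g/R\<close> where \<open>t \<ge> R\<close>.  Factors that are not
  differentiated lie in \<open>[0,1]\<close> and are bounded by their power \<open>r\<close>, so that all of
  \<open>cyl_cutoff\<close> reappears to the power \<open>r\<close>.
\<close>

lemma residual_bound:
  fixes z :: "real \<times> 'a::euclidean_space"
  assumes R: "R > 0" and \<epsilon>: "\<epsilon> > 0" "2 * \<epsilon> \<le> R" and \<mu>: "0 \<le> \<mu>" "\<mu> \<le> 1"
  shows "\<bar>residual \<mu> \<epsilon> R z\<bar>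
    \<le> indicator (shell R) z * ((1 + fst z) powr \<mu> * (cyl_cutoff \<epsilon> R z powr r * ((10 + 2 * real DIM('a)) * M / R\<^sup>2)))"
proof -
  obtain t x where z: "z = (t, x)" by (cases z)
  define g where "g = (1 + t) powr \<mu>"
  have g0: "g \<ge> 0" by (simp add: g_def)
  define P where "P = cyl_cutoff \<epsilon> R z powr r"
  have P0: "P \<ge> 0" by (simp add: P_def)
  define T1 where "T1 = (g * (S'' (t / R) / R\<^sup>2) + \<mu> * (1 + t) powr (\<mu> - 1) * (S' (t / R) / R)) * ball_cutoff R x"
  define T2 where "T2 = g * (onset \<epsilon> t * S (t / R)) * laplacian (ball_cutoff R) x"
  let ?I = "indicator (shell R) z :: real"
  have 1: "\<bar>T1\<bar> \<le> ?I * (g * (P * (2 * M / R\<^sup>2)))"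
  proof (cases "R \<le> t \<and> t \<le> 2 * R \<and> ball_cutoff R x \<noteq> 0")
    case True
    then have A: "z \<in> shell R"
      using ball_cutoff_eq_0[OF R, of x] R by (auto simp: shell_def z not_less[symmetric])
    define Q where "Q = M * S (t / R) powr r"
    have Q: "\<bar>S' (t / R)\<bar> \<le> Q" "\<bar>S'' (t / R)\<bar> \<le> Q" "0 \<le> Q" using M by (auto simp: Q_def)
    have "\<mu> * (1 + t) powr (\<mu> - 1) = \<mu> * (g / (1 + t))"
      using True R by (simp add: g_def powr_diff)
    also have "\<dots> \<le> 1 * (g / R)"
      using True R \<mu> g0 by (intro mult_mono divide_left_mono) auto
    finally have h: "\<mu> * (1 + t) powr (\<mu> - 1) \<le> g / R" by simp
    have "\<bar>g * (S'' (t / R) / R\<^sup>2) + \<mu> * (1 + t) powr (\<mu> - 1) * (S' (t / R) / R)\<bar>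
        \<le> g * (Q / R\<^sup>2) + g / R * (Q / R)"
    proof (rule order_trans[OF abs_triangle_ineq add_mono])
      show "\<bar>g * (S'' (t / R) / R\<^sup>2)\<bar> \<le> g * (Q / R\<^sup>2)"
        using g0 Q R by (simp add: abs_mult abs_divide mult_left_mono divide_right_mono)
      have "\<bar>S' (t / R) / R\<bar> \<le> Q / R" using Q R by (simp add: abs_divide divide_right_mono)
      then show "\<bar>\<mu> * (1 + t) powr (\<mu> - 1) * (S' (t / R) / R)\<bar> \<le> g / R * (Q / R)"
        using h \<mu> g0 R Q unfolding abs_mult[of "\<mu> * (1 + t) powr (\<mu> - 1)"] by (intro mult_mono) auto
    qed
    also have "\<dots> = 2 * g * Q / R\<^sup>2" by (simp add: power2_eq_square)
    finally have "\<bar>T1\<bar> \<le> 2 * g * Q / R\<^sup>2 * ball_cutoff R x powr r"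
      unfolding T1_def abs_mult
      using g0 Q ball_cutoff_bounds[of R x] le_powr_of_le_1[OF ball_cutoff_bounds, of r R x] r by (intro mult_mono) auto
    \<comment> \<open>as \<open>t \<ge> R \<ge> 2\<epsilon>\<close>, the onset factor equals \<open>1\<close> and can be inserted\<close>
    also have "\<dots> = g * (P * (2 * M / R\<^sup>2))"
      using True \<epsilon> onset_eq_1[OF \<epsilon>(1), of t] by (simp add: P_def Q_def cyl_cutoff_def z powr_mult)
    finally show ?thesis using A by simp
  next
    case False
    then have "ball_cutoff R x = 0 \<or> (t / R < 1 \<or> 2 < t / R)"
      using R by (auto simp: not_le pos_divide_less_eq pos_less_divide_eq)
    then have "T1 = 0" using S'_eq_0[of "t / R"] by (auto simp: T1_def)
    then show ?thesis using g0 P0 M(1) by simp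
  qed
  have 2: "\<bar>T2\<bar> \<le> ?I * (g * (P * ((8 + 2 * real DIM('a)) * M / R\<^sup>2)))"
  proof (cases "T2 = 0")
    case True
    then show ?thesis using g0 P0 M(1) by simp
  next
    case False
    then have "onset \<epsilon> t \<noteq> 0" "S (t / R) \<noteq> 0" and l: "laplacian (ball_cutoff R) x \<noteq> 0" by (auto simp: T2_def)
    then have "t > \<epsilon>" "\<not> 2 \<le> t / R" using onset_eq_0[OF \<epsilon>(1), of t] S_eq(2)[of "t / R"] by force+
    then have A: "z \<in> shell R"
      using \<epsilon> R laplacian_ball_cutoff_bound(2)[OF R l] by (auto simp: shell_def z pos_le_divide_eq)
    define Y where "Y = onset \<epsilon> t * S (t / R)"
    have Y: "0 \<le> Y" "Y \<le> 1" using onset_bounds[OF \<epsilon>(1), of t] S_bounds[of "t / R"]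
      by (auto simp: Y_def intro: mult_le_one)
    have "\<bar>T2\<bar> = g * Y * \<bar>laplacian (ball_cutoff R) x\<bar>"
      using g0 Y by (simp add: T2_def abs_mult Y_def[symmetric])
    also have "\<dots> \<le> g * Y powr r * ((8 + 2 * real DIM('a)) * M * ball_cutoff R x powr r / R\<^sup>2)"
      using g0 Y le_powr_of_le_1[OF Y, of r] r laplacian_ball_cutoff_bound(1)[OF R, of x] by (intro mult_mono) auto
    also have "\<dots> = g * (P * ((8 + 2 * real DIM('a)) * M / R\<^sup>2))"
      by (simp add: P_def cyl_cutoff_def z powr_mult Y_def)
    finally show ?thesis using A by simp
  qed
  have "\<bar>residual \<mu> \<epsilon> R z\<bar> \<le> \<bar>T1\<bar> + \<bar>T2\<bar>"
    unfolding residual_def T1_def T2_def g_def z fst_conv snd_conv by (rule abs_triangle_ineq4)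
  also have "\<dots> \<le> ?I * (g * (P * ((10 + 2 * real DIM('a)) * M / R\<^sup>2)))"
    using add_mono[OF 1 2] by (simp add: algebra_simps add_divide_distrib)
  finally show ?thesis by (simp add: g_def P_def z)
qed

definition weighted_power :: "real \<Rightarrow> real \<Rightarrow> (real \<times> 'a::euclidean_space \<Rightarrow> real) \<Rightarrow> real \<Rightarrow> real \<Rightarrow> real \<times> 'a \<Rightarrow> real" where
  "weighted_power \<mu> p w \<epsilon> R z = \<bar>w z\<bar> powr p * ((1 + fst z) powr \<mu> * cyl_cutoff \<epsilon> R z)"

lemma weighted_power_nonneg: "\<epsilon> > 0 \<Longrightarrow> weighted_power \<mu> p w \<epsilon> R z \<ge> 0"
  by (simp add: weighted_power_def cyl_cutoff_bounds)

text \<open>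
  The cylinder carrying the cutoff at size \<open>R\<close> is disjoint from the shell at size \<open>4R\<close>, and on it
  the cutoff at size \<open>4R\<close> has only the onset factor left.
\<close>

lemma weighted_power_step:
  fixes w :: "real \<times> 'a::euclidean_space \<Rightarrow> real"
  assumes R: "R > 0" and \<epsilon>: "\<epsilon> > 0"
  shows "weighted_power \<mu> p w \<epsilon> R z + indicator (shell (4 * R)) z * weighted_power \<mu> p w \<epsilon> (4 * R) z
     \<le> weighted_power \<mu> p w \<epsilon> (4 * R) z"
proof (cases "z \<in> shell (4 * R)")
  case True
  then have "2 \<le> fst z / R \<or> norm (snd z) > 2 * R"
    using R by (auto simp: shell_def pos_le_divide_eq)
  then have "cyl_cutoff \<epsilon> R z = 0" using S_eq(2) ball_cutoff_eq_0[OF R] by (auto simp: cyl_cutoff_def)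
  then show ?thesis using True by (simp add: weighted_power_def)
next
  case False
  have "cyl_cutoff \<epsilon> R z \<le> cyl_cutoff \<epsilon> (4 * R) z"
  proof (cases "cyl_cutoff \<epsilon> R z = 0")
    case True
    then show ?thesis using cyl_cutoff_bounds[OF \<epsilon>] by simp
  next
    case F: False
    then have "fst z / R < 2" "norm (snd z) \<le> 2 * R"
      using S_eq(2)[of "fst z / R"] ball_cutoff_eq_0[OF R, of "snd z"] by (auto simp: cyl_cutoff_def not_less[symmetric])
    then have "S (fst z / (4 * R)) = 1" "ball_cutoff (4 * R) (snd z) = 1"
      using R by (auto intro!: S_eq ball_cutoff_eq_1 simp: divide_simps split: if_splits)
    then show ?thesis using onset_bounds(1)[OF \<epsilon>, of "fst z"] S_bounds[of "fst z / R"] ball_cutoff_bounds[of R "snd z"]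
      by (simp add: cyl_cutoff_def mult_left_le mult_le_one mult.assoc)
  qed
  then show ?thesis using False by (simp add: weighted_power_def mult_left_mono)
qed

text \<open>
  The central estimate.  Its constant \<open>K\<close> depends neither on \<open>R\<close> nor on \<open>\<epsilon>\<close>, and the parameter
  \<open>l\<close> is free: small \<open>l\<close> bounds the full integral, large \<open>l\<close> bounds the shell integral from below.
\<close>

lemma test_function_inequality:
  fixes w :: "real \<times> 'a::euclidean_space \<Rightarrow> real"
  assumes p: "1 < p" "r = 1 / p" "p \<le> 1 + 2 / (real DIM('a) + (\<mu> - 1))" and \<mu>: "0 < \<mu>" "\<mu> \<le> 1"
    and sol: "distr_solution \<mu> p w"
    and u: "has_curve_deriv L2 L2_norm u v" and v: "continuous_curve L2 L2_norm v"
    and wu: "\<And>t. t > 0 \<Longrightarrow> AE x in lebesgue. w (t, x) = u t x"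
    and R: "R \<ge> 1" and \<epsilon>: "\<epsilon> > 0" "2 * \<epsilon> \<le> R"
    and c: "c \<ge> 0" "\<And>t. 0 \<le> t \<Longrightarrow> t \<le> 3 * \<epsilon> \<Longrightarrow> c \<le> (LINT x|lebesgue. v t x * ball_cutoff R x)"
    and l: "l > 0"
  defines "K \<equiv> 3 powr \<mu> * ((10 + 2 * real DIM('a)) * M) powr (p / (p - 1))
                * (unit_ball_vol (real (DIM('a) + 1)) * 4 ^ (DIM('a) + 1))"
  shows "integrable lebesgue (weighted_power \<mu> p w \<epsilon> R)"
    and "(LINT z|lebesgue. weighted_power \<mu> p w \<epsilon> R z) + c
      \<le> l * (LINT z|lebesgue. indicator (shell R) z * weighted_power \<mu> p w \<epsilon> R z) + l powr (- 1 / (p - 1)) * K"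
proof -
  have R0: "R > 0" using R by simp
  obtain \<theta>' where \<theta>': "elementary_smooth \<theta>'" "\<And>t. (onset \<epsilon> has_real_derivative \<theta>' t) (at t)"
    using es_real_derivative[OF es_onset[OF \<epsilon>(1)]] by blast
  obtain \<theta>'' where \<theta>'': "elementary_smooth \<theta>''" "\<And>t. (\<theta>' has_real_derivative \<theta>'' t) (at t)"
    using es_real_derivative[OF \<theta>'(1)] by blast
  define \<eta> \<eta>' \<eta>'' where "\<eta> t = S (t / R)" and "\<eta>' t = S' (t / R) / R" and "\<eta>'' t = S'' (t / R) / R\<^sup>2" for t
  have es1: "elementary_smooth (\<lambda>t. t / R)" using es_cmult[OF es_id, of "1 / R"] by simp
  have es\<eta>: "elementary_smooth \<eta>" "elementary_smooth \<eta>'" "elementary_smooth \<eta>''"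
    using es_compose[OF es_S(1) es1] es_cmult[OF es_compose[OF es_S(2) es1], of "1 / R"]
      es_cmult[OF es_compose[OF es_S(3) es1], of "1 / R\<^sup>2"]
    by (simp_all add: \<eta>_def[abs_def] \<eta>'_def[abs_def] \<eta>''_def[abs_def])
  have d1: "((\<lambda>t. t / R) has_real_derivative (1 / R)) (at t)" for t
    using R0 by (auto intro!: derivative_eq_intros)
  have d\<eta>: "(\<eta> has_real_derivative \<eta>' t) (at t)" "(\<eta>' has_real_derivative \<eta>'' t) (at t)" for t
    using DERIV_chain2[OF deriv_S(1) d1] DERIV_cdivide[OF DERIV_chain2[OF deriv_S(2) d1], of R]
    by (simp_all add: \<eta>_def[abs_def] \<eta>'_def[abs_def] \<eta>''_def power2_eq_square)
  \<comment> \<open>since \<open>2\<epsilon> \<le> R\<close>, one of the factors \<open>onset\<close> and \<open>\<eta>\<close> is \<open>1\<close> at every time, so their product is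
      also \<open>onset + \<eta> - 1\<close>, and the time derivatives split without mixed terms\<close>
  define \<zeta> \<zeta>' \<zeta>'' where "\<zeta> t = onset \<epsilon> t + \<eta> t - 1" and "\<zeta>' t = \<theta>' t + \<eta>' t"
    and "\<zeta>'' t = \<theta>'' t + \<eta>'' t" for t
  have \<zeta>_prod: "\<zeta> t = onset \<epsilon> t * S (t / R)" for t
  proof (cases "t \<le> 2 * \<epsilon>")
    case True
    then have "\<eta> t = 1" using \<epsilon> R0 by (auto simp: \<eta>_def intro!: S_eq)
    then show ?thesis by (simp add: \<zeta>_def \<eta>_def)
  next
    case False
    then show ?thesis using onset_eq_1[OF \<epsilon>(1), of t] by (simp add: \<zeta>_def \<eta>_def)
  qed
  have z\<zeta>: "\<zeta> t = 0" if "t < \<epsilon> \<or> t > 2 * R" for t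
    using that onset_eq_0[OF \<epsilon>(1), of t] S_eq(2)[of "t / R"] R0
    by (auto simp: \<zeta>_prod pos_le_divide_eq)
  have es\<zeta>: "elementary_smooth \<zeta>" "elementary_smooth \<zeta>'" "elementary_smooth \<zeta>''"
    unfolding \<zeta>_def[abs_def] \<zeta>'_def[abs_def] \<zeta>''_def[abs_def]
    by (intro es_add es_diff es_const es\<eta> es_onset[OF \<epsilon>(1)] \<theta>' \<theta>'')+
  have d\<zeta>: "(\<zeta> has_real_derivative \<zeta>' t) (at t)" "(\<zeta>' has_real_derivative \<zeta>'' t) (at t)" for t
    unfolding \<zeta>_def[abs_def] \<zeta>'_def[abs_def] \<zeta>''_def
    using DERIV_diff[OF DERIV_add[OF \<theta>'(2) d\<eta>(1)] DERIV_const[of 1]] DERIV_add[OF \<theta>''(2) d\<eta>(2)] by simp_all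
  define time where "time = (\<lambda>(f'::real \<Rightarrow> real) f'' t. (1 + t) powr \<mu> * f'' t + \<mu> * (1 + t) powr (\<mu> - 1) * f' t)"
  note weak = weak_formulation_tensor[OF sol es\<zeta> d\<zeta> \<epsilon>(1) z\<zeta> es_ball_cutoff[of R] ball_cutoff_eq_0[OF R0]]
  show intD: "integrable lebesgue (weighted_power \<mu> p w \<epsilon> R)"
    using weak(1) by (simp add: weighted_power_def[abs_def] cyl_cutoff_def \<zeta>_prod mult.assoc)
  have int_\<zeta>: "integrable lebesgue (\<lambda>z. w z * (time \<zeta>' \<zeta>'' (fst z) * ball_cutoff R (snd z)))"
    using weak(2) by (simp add: time_def)
  have lw: "locally_integrable_on w ({0<..} \<times> UNIV)" using sol by (simp add: distr_solution_def)
  note z1 = onset_derivs_eq_0(1)[OF \<epsilon>(1) _ \<theta>'(2) \<theta>''(2)]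
    and z2 = onset_derivs_eq_0(2)[OF \<epsilon>(1) _ \<theta>'(2) \<theta>''(2)]
  have int_\<theta>: "integrable lebesgue (\<lambda>z. w z * (time \<theta>' \<theta>'' (fst z) * ball_cutoff R (snd z)))"
  proof (rule integrable_tensor[OF lw \<epsilon>(1), of _ "2 * \<epsilon>" _ "2 * R"])
    show "continuous_on UNIV (time \<theta>' \<theta>'')"
      unfolding time_def
      by (intro continuous_on_add continuous_weighted[OF _ es_continuous[OF \<theta>''(1)] \<epsilon>(1)]
          continuous_weighted[OF _ es_continuous[OF \<theta>'(1)] \<epsilon>(1)] continuous_intros) (use z1 z2 in auto)
    show "time \<theta>' \<theta>'' t = 0" if "t < \<epsilon> \<or> t > 2 * \<epsilon>" for t
      using z1[OF that] z2[OF that] by (simp add: time_def)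
  qed (use es_continuous[OF es_ball_cutoff] ball_cutoff_eq_0[OF R0] in auto)
  have int_\<eta>: "integrable lebesgue (\<lambda>z. w z * (time \<eta>' \<eta>'' (fst z) * ball_cutoff R (snd z)))"
    using Bochner_Integration.integrable_diff[OF int_\<zeta> int_\<theta>]
    by (simp add: time_def \<zeta>'_def \<zeta>''_def algebra_simps)
  have cut_L2: "(ball_cutoff R :: 'a \<Rightarrow> real) \<in> L2" by (rule ball_cutoff_L2[OF R0])
  have layer: "(LINT z|lebesgue. w z * (time \<theta>' \<theta>'' (fst z) * ball_cutoff R (snd z))) \<le> - c"
    using initial_layer[OF u v cut_L2 wu less_imp_le[OF \<mu>(1)] c(1) c(2) \<epsilon>(1) \<theta>' \<theta>''] int_\<theta>
    by (simp add: time_def)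
  have res: "w z * residual \<mu> \<epsilon> R z = w z * (time \<eta>' \<eta>'' (fst z) * ball_cutoff R (snd z))
     - w z * ((1 + fst z) powr \<mu> * \<zeta> (fst z) * laplacian (ball_cutoff R) (snd z))" for z
    by (simp add: residual_def time_def \<eta>'_def \<eta>''_def \<zeta>_prod algebra_simps)
  have int_res: "integrable lebesgue (\<lambda>z. w z * residual \<mu> \<epsilon> R z)"
    unfolding res by (rule Bochner_Integration.integrable_diff[OF int_\<eta> weak(3)])
  have "(LINT z|lebesgue. weighted_power \<mu> p w \<epsilon> R z)
     = (LINT z|lebesgue. w z * (time \<zeta>' \<zeta>'' (fst z) * ball_cutoff R (snd z)))
       - (LINT z|lebesgue. w z * ((1 + fst z) powr \<mu> * \<zeta> (fst z) * laplacian (ball_cutoff R) (snd z)))"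
    using weak(4) by (simp add: weighted_power_def cyl_cutoff_def \<zeta>_prod time_def mult.assoc)
  also have "(LINT z|lebesgue. w z * (time \<zeta>' \<zeta>'' (fst z) * ball_cutoff R (snd z)))
     = (LINT z|lebesgue. w z * (time \<theta>' \<theta>'' (fst z) * ball_cutoff R (snd z)))
       + (LINT z|lebesgue. w z * (time \<eta>' \<eta>'' (fst z) * ball_cutoff R (snd z)))"
    unfolding Bochner_Integration.integral_add[OF int_\<theta> int_\<eta>, symmetric]
    by (simp add: time_def \<zeta>'_def \<zeta>''_def algebra_simps)
  finally have main': "(LINT z|lebesgue. weighted_power \<mu> p w \<epsilon> R z)
     = (LINT z|lebesgue. w z * (time \<theta>' \<theta>'' (fst z) * ball_cutoff R (snd z)))
       + (LINT z|lebesgue. w z * (time \<eta>' \<eta>'' (fst z) * ball_cutoff R (snd z)))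
       - (LINT z|lebesgue. w z * ((1 + fst z) powr \<mu> * \<zeta> (fst z) * laplacian (ball_cutoff R) (snd z)))" .
  have main: "(LINT z|lebesgue. weighted_power \<mu> p w \<epsilon> R z) + c \<le> (LINT z|lebesgue. w z * residual \<mu> \<epsilon> R z)"
  proof -
    have "(LINT z|lebesgue. w z * residual \<mu> \<epsilon> R z)
       = (LINT z|lebesgue. w z * (time \<eta>' \<eta>'' (fst z) * ball_cutoff R (snd z)))
       - (LINT z|lebesgue. w z * ((1 + fst z) powr \<mu> * \<zeta> (fst z) * laplacian (ball_cutoff R) (snd z)))"
      unfolding res by (rule Bochner_Integration.integral_diff[OF int_\<eta> weak(3)])
    with layer main' show ?thesis by linarith
  qed
  define q where "q = p / (p - 1)"
  define E where "E = (10 + 2 * real DIM('a)) * M"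
  have E: "E \<ge> 0" using M(1) by (simp add: E_def)
  define L where "L = l powr (- 1 / (p - 1)) * ((3 * R) powr \<mu> * (E / R\<^sup>2) powr q)"
  have L: "L \<ge> 0" by (simp add: L_def)
  \<comment> \<open>Young's inequality pointwise, separating \<open>|w|\<^sup>p\<close> from the size of the derivatives\<close>
  have pt: "w z * residual \<mu> \<epsilon> R z
     \<le> l * (indicator (shell R) z * weighted_power \<mu> p w \<epsilon> R z) + L * indicator (cball 0 (4 * R)) z" for z
  proof (cases "z \<in> shell R")
    case True
    define g where "g = (1 + fst z) powr \<mu>"
    have g: "0 \<le> g" "g \<le> (3 * R) powr \<mu>"
      using True R \<mu> by (auto simp: g_def shell_def intro!: powr_mono2)
    have "w z * residual \<mu> \<epsilon> R z \<le> \<bar>w z\<bar> * \<bar>residual \<mu> \<epsilon> R z\<bar>"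
      by (metis abs_ge_self abs_mult)
    also have "\<dots> \<le> \<bar>w z\<bar> * (g * (cyl_cutoff \<epsilon> R z powr r * (E / R\<^sup>2)))"
      using residual_bound[OF R0 \<epsilon>, of \<mu> z] \<mu> True by (intro mult_left_mono) (auto simp: g_def E_def)
    also have "\<dots> = g * ((\<bar>w z\<bar> * cyl_cutoff \<epsilon> R z powr r) * (E / R\<^sup>2))" by simp
    also have "\<dots> \<le> g * (l * (\<bar>w z\<bar> * cyl_cutoff \<epsilon> R z powr r) powr p + l powr (- 1 / (p - 1)) * (E / R\<^sup>2) powr q)"
      unfolding q_def using E R0 l p(1) g by (intro mult_left_mono Youngs_inequality_weighted) auto
    also have "(\<bar>w z\<bar> * cyl_cutoff \<epsilon> R z powr r) powr p = \<bar>w z\<bar> powr p * cyl_cutoff \<epsilon> R z"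
      using p cyl_cutoff_bounds[OF \<epsilon>(1), of R z] by (simp add: powr_mult powr_powr)
    also have "g * (l * (\<bar>w z\<bar> powr p * cyl_cutoff \<epsilon> R z) + l powr (- 1 / (p - 1)) * (E / R\<^sup>2) powr q)
      = l * weighted_power \<mu> p w \<epsilon> R z + l powr (- 1 / (p - 1)) * (g * (E / R\<^sup>2) powr q)"
      by (simp add: weighted_power_def g_def algebra_simps)
    also have "\<dots> \<le> l * weighted_power \<mu> p w \<epsilon> R z + L"
      unfolding L_def using g by (intro add_left_mono mult_left_mono mult_right_mono) auto
    finally show ?thesis using True shell_subset_cball[of R] by auto
  next
    case False
    then have "residual \<mu> \<epsilon> R z = 0" using residual_bound[OF R0 \<epsilon>, of \<mu> z] \<mu> by simp
    then show ?thesis using False L by simp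
  qed
  have int_A: "integrable lebesgue (\<lambda>z. indicator (shell R) z * weighted_power \<mu> p w \<epsilon> R z)"
    using integrable_mult_indicator[OF shell_measurable intD, of R] by simp
  have int_ball: "integrable lebesgue (indicator (cball (0 :: real \<times> 'a) (4 * R)) :: _ \<Rightarrow> real)"
    by (rule integrable_real_indicator) (use emeasure_lborel_cball_finite[of "0 :: real \<times> 'a" "4 * R"] in auto)
  have "(LINT z|lebesgue. w z * residual \<mu> \<epsilon> R z)
    \<le> (LINT z|lebesgue. l * (indicator (shell R) z * weighted_power \<mu> p w \<epsilon> R z) + L * indicator (cball 0 (4 * R)) z)"
    by (rule integral_mono[OF int_res _ pt]) (use int_A int_ball in auto)
  also have "\<dots> = l * (LINT z|lebesgue. indicator (shell R) z * weighted_power \<mu> p w \<epsilon> R z)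
     + L * measure lebesgue (cball (0 :: real \<times> 'a) (4 * R))"
    using int_A int_ball by simp
  also have "measure lebesgue (cball (0 :: real \<times> 'a) (4 * R))
      = unit_ball_vol (real (DIM('a) + 1)) * 4 ^ (DIM('a) + 1) * R ^ (DIM('a) + 1)"
    using content_cball[of "4 * R" "0 :: real \<times> 'a"] R0
    by (simp add: power_mult_distrib add.commute)
  also have "L * \<dots> = l powr (- 1 / (p - 1)) * K * (R powr (\<mu> + (real DIM('a) + 1)) * (1 / R\<^sup>2) powr q)"
  proof -
    have "R ^ (DIM('a) + 1) = R powr (real DIM('a) + 1)"
      using R0 by (subst powr_realpow[symmetric]) (auto simp: add.commute)
    moreover have "(E / R\<^sup>2) powr q = E powr q * (1 / R\<^sup>2) powr q"
      using powr_mult[of E "1 / R\<^sup>2" q] by simp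
    ultimately show ?thesis
      by (simp add: L_def K_def powr_mult powr_add E_def q_def)
  qed
  also have "\<dots> \<le> l powr (- 1 / (p - 1)) * K * 1"
  proof (rule mult_left_mono)
    show "R powr (\<mu> + (real DIM('a) + 1)) * (1 / R\<^sup>2) powr q \<le> 1"
      unfolding q_def using critical_scaling[OF _ \<mu>(1) p(1) p(3) R] DIM_positive[where 'a='a] by simp
    show "0 \<le> l powr (- 1 / (p - 1)) * K" by (simp add: K_def)
  qed
  finally show "(LINT z|lebesgue. weighted_power \<mu> p w \<epsilon> R z) + c
      \<le> l * (LINT z|lebesgue. indicator (shell R) z * weighted_power \<mu> p w \<epsilon> R z) + l powr (- 1 / (p - 1)) * K"
    using main by simp
qed

end

section \<open>Nonexistence\<close>

text \<open>
  The complement of the essential support is a union of open sets on each of which \<open>f\<close> vanishes almost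
  everywhere; by the Lindelof property countably many of them suffice.
\<close>

lemma AE_zero_outside_ess_support:
  fixes f :: "'a::euclidean_space \<Rightarrow> real"
  shows "AE x in lebesgue. x \<notin> ess_support f \<longrightarrow> f x = 0"
proof -
  let ?\<U> = "{U. open U \<and> (AE x in lebesgue. x \<in> U \<longrightarrow> f x = 0)}"
  obtain \<V> where V: "\<V> \<subseteq> ?\<U>" "countable \<V>" "\<Union>\<V> = \<Union>?\<U>"
    using Lindelof[of ?\<U>] by auto
  have "AE x in lebesgue. \<forall>U\<in>\<V>. x \<in> U \<longrightarrow> f x = 0"
    using V by (subst AE_ball_countable) auto
  then show ?thesis
    by eventually_elim (use V(3) in \<open>auto simp: ess_support_def\<close>)
qed

lemma (in cutoff) integral_mult_ball_cutoff:
  fixes f :: "'a::euclidean_space \<Rightarrow> real"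
  assumes "f \<in> borel_measurable lebesgue" "R > 0" "ess_support f \<subseteq> cball 0 R"
  shows "(LINT x|lebesgue. f x * ball_cutoff R x) = (LINT x|lebesgue. f x)"
proof (rule integral_cong_AE)
  have "(ball_cutoff R :: 'a \<Rightarrow> real) \<in> borel_measurable lborel"
    using borel_measurable_continuous_onI[OF es_continuous[OF es_ball_cutoff]] by simp
  then show "(\<lambda>x. f x * ball_cutoff R x) \<in> borel_measurable lebesgue"
    by (rule borel_measurable_times[OF assms(1) measurable_completion])
  show "AE x in lebesgue. f x * ball_cutoff R x = f x"
    using AE_zero_outside_ess_support[of f]
  proof eventually_elim
    case (elim x)
    then show ?case using assms(3) ball_cutoff_eq_1[OF assms(2), of x] by (cases "x \<in> ess_support f") auto
  qed
qed (rule assms(1))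

lemma no_global_solution:
  fixes \<mu> p :: real and u0 u1 :: "'a::euclidean_space \<Rightarrow> real"
  assumes \<mu>: "0 < \<mu>" "\<mu> \<le> 1" and p: "1 < p" "p \<le> 1 + 2 / (real DIM('a) + (\<mu> - 1))"
    and u1: "u1 \<in> L2" "compact (ess_support u1)" "(LINT x|lebesgue. u1 x) > 0"
  shows "\<not> global_solution \<mu> p u0 u1 u"
proof
  assume "global_solution \<mu> p u0 u1 u"
  then obtain v w where u: "has_curve_deriv L2 L2_norm u v" and v: "continuous_curve L2 L2_norm v"
    and v0: "AE x in lebesgue. v 0 x = u1 x"
    and wu: "\<And>t. t > 0 \<Longrightarrow> AE x in lebesgue. w (t, x) = u t x" and sol: "distr_solution \<mu> p w"
    unfolding global_solution_def by blast
  have "0 < 1 / p" "1 / p < 1" using p by auto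
  from cutoff_exists[OF this] obtain S S' S'' M where "cutoff (1 / p) S S' S'' M" by blast
  then interpret cutoff "1 / p" S S' S'' M .
  \<comment> \<open>half of the initial value of the pairing of \<open>v\<close> with a wide cutoff; by continuity the pairing
      stays above it for a short time\<close>
  define c where "c = (LINT x|lebesgue. u1 x) / 2"
  have c: "c > 0" using u1 by (simp add: c_def)
  define K where "K = 3 powr \<mu> * ((10 + 2 * real DIM('a)) * M) powr (p / (p - 1))
                * (unit_ball_vol (real (DIM('a) + 1)) * 4 ^ (DIM('a) + 1))"
  have K: "K \<ge> 0" by (simp add: K_def)
  obtain R0 where R0: "R0 \<ge> 1" "ess_support u1 \<subseteq> cball 0 R0"
  proof -
    obtain B where "\<forall>x\<in>ess_support u1. norm x \<le> B"
      using compact_imp_bounded[OF u1(2)] by (auto simp: bounded_iff)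
    then show ?thesis by (intro that[of "max 1 B"]) (auto simp: le_max_iff_disj)
  qed
  have L2_cut: "(ball_cutoff R :: 'a \<Rightarrow> real) \<in> L2" if "R > 0" for R by (rule ball_cutoff_L2[OF that])
  have layer: "\<exists>e>0. \<forall>t. 0 \<le> t \<and> t \<le> e \<longrightarrow> c \<le> (LINT x|lebesgue. v t x * ball_cutoff R x)" if R: "R \<ge> R0" for R
  proof -
    have R': "R > 0" "ess_support u1 \<subseteq> cball 0 R" using R R0 by auto
    define V where "V t = (LINT x|lebesgue. v t x * ball_cutoff R x)" for t
    have m: "v 0 \<in> L2" using v by (auto simp: continuous_curve_def)
    have "V 0 = (LINT x|lebesgue. u1 x * ball_cutoff R x)"
      unfolding V_def
    proof (rule integral_cong_AE)
      show "(\<lambda>x. v 0 x * ball_cutoff R x) \<in> borel_measurable lebesgue" "(\<lambda>x. u1 x * ball_cutoff R x) \<in> borel_measurable lebesgue"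
        using L2_mult(1)[OF m L2_cut[OF R'(1)]] L2_mult(1)[OF u1(1) L2_cut[OF R'(1)]]
        by (auto dest: borel_measurable_integrable)
      show "AE x in lebesgue. v 0 x * ball_cutoff R x = u1 x * ball_cutoff R x" using v0 by eventually_elim simp
    qed
    also have "\<dots> = 2 * c"
      using integral_mult_ball_cutoff[OF _ R'] u1(1) by (simp add: L2_def c_def)
    finally have V0: "V 0 = 2 * c" .
    have "continuous_on {0..} V"
      unfolding V_def[abs_def] by (rule curve_pairing_continuous[OF v L2_cut[OF R'(1)]])
    then obtain d where d: "d > 0" "\<And>t. t \<in> {0..} \<Longrightarrow> dist t 0 < d \<Longrightarrow> dist (V t) (V 0) < c"
      using c unfolding continuous_on_iff by (metis atLeast_iff order_refl)
    have "c \<le> V t" if "0 \<le> t" "t \<le> d / 2" for t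
      using d(2)[of t] that d(1) V0 by (auto simp: dist_real_def)
    then show ?thesis unfolding V_def using d(1) by (intro exI[of _ "d / 2"]) auto
  qed
  let ?I = "\<lambda>\<epsilon> R. LINT z|lebesgue. weighted_power \<mu> p w \<epsilon> R z"
  let ?J = "\<lambda>\<epsilon> R. LINT z|lebesgue. indicator (shell R) z * weighted_power \<mu> p w \<epsilon> R z"
  \<comment> \<open>\<open>\<epsilon>\<close> is small enough for the test function inequality at size \<open>R\<close>\<close>
  define admissible where "admissible \<epsilon> R \<longleftrightarrow> R \<ge> 1 \<and> \<epsilon> > 0 \<and> 2 * \<epsilon> \<le> R \<and>
     (\<forall>t. 0 \<le> t \<and> t \<le> 3 * \<epsilon> \<longrightarrow> c \<le> (LINT x|lebesgue. v t x * ball_cutoff R x))" for \<epsilon> R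
  have int: "integrable lebesgue (weighted_power \<mu> p w \<epsilon> R)"
    and energy: "l > 0 \<Longrightarrow> ?I \<epsilon> R + c \<le> l * ?J \<epsilon> R + l powr (- 1 / (p - 1)) * K" if "admissible \<epsilon> R" for \<epsilon> R l
    using that c test_function_inequality[OF p(1) refl p(2) \<mu> sol u v wu, of R \<epsilon> c l]
      test_function_inequality(1)[OF p(1) refl p(2) \<mu> sol u v wu, of R \<epsilon> c 1]
    unfolding admissible_def K_def by auto
  have int_A: "integrable lebesgue (\<lambda>z. indicator (shell R) z * weighted_power \<mu> p w \<epsilon> R z)" if "admissible \<epsilon> R" for \<epsilon> R
    using integrable_mult_indicator[OF shell_measurable int[OF that], of R] by simp
  have I0: "0 \<le> ?I \<epsilon> R" if "admissible \<epsilon> R" for \<epsilon> R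
    using that by (intro Bochner_Integration.integral_nonneg weighted_power_nonneg) (simp add: admissible_def)
  have upper: "?I \<epsilon> R \<le> 2 * ((1 / 2) powr (- 1 / (p - 1)) * K)" if "admissible \<epsilon> R" for \<epsilon> R
  proof -
    have "?J \<epsilon> R \<le> ?I \<epsilon> R"
      by (rule integral_mono[OF int_A[OF that] int[OF that]])
         (use that in \<open>auto simp: admissible_def weighted_power_nonneg split: split_indicator\<close>)
    then show ?thesis using energy[OF that, of "1 / 2"] c by simp
  qed
  \<comment> \<open>large enough for the remainder to be at most half of the contribution \<open>c\<close> of the initial
      velocity\<close>
  define l where "l = (2 * K / c + 1) powr (p - 1)"
  have pos: "2 * K / c + 1 > 0" using K c by (intro add_nonneg_pos) auto
  then have l: "l > 0" by (simp add: l_def)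
  have lK: "l powr (- 1 / (p - 1)) * K \<le> c / 2"
  proof -
    have "l powr (- 1 / (p - 1)) = (2 * K / c + 1) powr (- 1)"
      using p(1) by (simp add: l_def powr_powr)
    also have "\<dots> = 1 / (2 * K / c + 1)" using pos by (simp add: powr_minus divide_inverse)
    finally have eq: "l powr (- 1 / (p - 1)) = 1 / (2 * K / c + 1)" .
    have "c / 2 * (2 * K / c + 1) = K + c / 2" using c by (simp add: field_simps)
    then have "K \<le> c / 2 * (2 * K / c + 1)" using c by simp
    then show ?thesis unfolding eq using pos by (simp add: pos_divide_le_eq)
  qed
  define \<delta> where "\<delta> = c / (2 * l)"
  have \<delta>: "\<delta> > 0" using c l by (simp add: \<delta>_def)
  have lower: "\<delta> \<le> ?J \<epsilon> R" if "admissible \<epsilon> R" for \<epsilon> R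
    using energy[OF that l] I0[OF that] lK l by (simp add: \<delta>_def field_simps)
  obtain N :: nat where N: "2 * ((1 / 2) powr (- 1 / (p - 1)) * K) < real N * \<delta>"
    using ex_less_of_nat_mult[OF \<delta>] by blast
  define Rs where "Rs j = 4 ^ j * R0" for j :: nat
  have Rs: "Rs j \<ge> R0" for j using R0 by (simp add: Rs_def mult_le_cancel_right1)
  have "\<forall>j. \<exists>e>0. \<forall>t. 0 \<le> t \<and> t \<le> e \<longrightarrow> c \<le> (LINT x|lebesgue. v t x * ball_cutoff (Rs j) x)"
    by (intro allI layer Rs)
  from choice[OF this] obtain e where e: "\<And>j. e j > 0"
      "\<And>j t. 0 \<le> t \<Longrightarrow> t \<le> e j \<Longrightarrow> c \<le> (LINT x|lebesgue. v t x * ball_cutoff (Rs j) x)"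
    by blast
  \<comment> \<open>one onset time for all radii up to \<open>Rs N\<close>\<close>
  define \<epsilon> where "\<epsilon> = Min (insert (1 / 2) ((\<lambda>j. e j / 3) ` {..N}))"
  have \<epsilon>: "\<epsilon> > 0" "\<epsilon> \<le> 1 / 2"
    using e(1) by (auto simp: \<epsilon>_def)
  have \<epsilon>_le: "\<epsilon> \<le> e j / 3" if "j \<le> N" for j
    unfolding \<epsilon>_def by (rule Min_le) (use that in auto)
  have admissible: "admissible \<epsilon> (Rs j)" if "j \<le> N" for j
    unfolding admissible_def using \<epsilon> \<epsilon>_le[OF that] Rs[of j] R0 by (auto intro!: e(2))
  have "real j * \<delta> \<le> ?I \<epsilon> (Rs j)" if "j \<le> N" for j
    using that
  proof (induction j)
    case 0
    then show ?case using I0[OF admissible[of 0]] by simp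
  next
    case (Suc j)
    have g: "admissible \<epsilon> (Rs j)" "admissible \<epsilon> (4 * Rs j)" "Rs (Suc j) = 4 * Rs j"
      using Suc.prems admissible[of j] admissible[of "Suc j"] by (auto simp: Rs_def mult.assoc)
    have "?I \<epsilon> (Rs j) + ?J \<epsilon> (4 * Rs j)
      = (LINT z|lebesgue. weighted_power \<mu> p w \<epsilon> (Rs j) z + indicator (shell (4 * Rs j)) z * weighted_power \<mu> p w \<epsilon> (4 * Rs j) z)"
      by (rule Bochner_Integration.integral_add[OF int[OF g(1)] int_A[OF g(2)], symmetric])
    also have "\<dots> \<le> ?I \<epsilon> (4 * Rs j)"
      by (rule integral_mono[OF Bochner_Integration.integrable_add[OF int[OF g(1)] int_A[OF g(2)]] int[OF g(2)]])
         (use \<epsilon> Rs[of j] R0 in \<open>auto intro!: weighted_power_step\<close>)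
    finally show ?case using Suc lower[OF g(2)] g(3) by (simp add: algebra_simps)
  qed
  from this[of N] upper[OF admissible[of N]] N show False by simp
qed

theorem theorem1p4:
  fixes \<mu> p :: real and u0 u1 :: "real ^ 'n \<Rightarrow> real"
  assumes "0 < \<mu>" and "\<mu> \<le> 1"
    and "1 < p" and "p \<le> 1 + 2 / (real CARD('n) + (\<mu> - 1))"
    and "u0 \<in> H1" and "u1 \<in> L2"
    and "compact (ess_support u0)" and "compact (ess_support u1)"
    and "(LINT x|lebesgue. u1 x) > 0"
  shows "\<not> (\<exists>u. global_solution \<mu> p u0 u1 u)"
  using no_global_solution[of \<mu> p u1 u0] assms by simp

end
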